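(* Let $n$ be a positive integer, let $A_0,A_1,\ldots,A_n$ be entire functions with orders $\sigma_0,\sigma_1,\ldots,\sigma_n$ respectively, such that $\sigma_l>\max_{k\in\{0,1,\ldots,n\}\setminus\{l\}}\sigma_k$ for some $l\in\{0,1,\ldots,n\}$, and let $f$ be a non-trivial (i.e. not identically zero) meromorphic solution on $\mathbb{C}$ of the Wilson interpolation equation $$A_n(x)y(x^{+(n)})+A_{n-1}(x)y(x^{+(n-1)})+\cdots+A_1(x)y(x^+)+A_0(x)y(x)=0.$$ Then $f$ has order $\sigma\ge\sigma_l+\frac12$.
   Context: Fix a branch $\sqrt{\cdot}$ of the square root with the imaginary axis (in the plane of $z=\sqrt x$) as branch cut: for $x\notin(-\infty,0]$ the values $\sqrt x$ lie in one fixed open half-plane bounded by the imaginary axis, and $\sqrt{-t^2}=it$ for $t\ge0$. Put $x^+:=(\sqrt x+\frac i2)^2$, $x^{+(0)}:=x$ and $x^{+(m)}:=(x^{+(m-1)})^+$ for $m\ge1$. The order of a meromorphic function $f$ is $\limsup_{r\to\infty}\frac{\ln^+T(r,f)}{\ln r}\in[0,+\infty]$, with $T$ the Nevanlinna characteristic. *)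

theory Defs
  imports "HOL-Complex_Analysis.Complex_Analysis"
begin

section \<open>Nevanlinna characteristic and order\<close>

definition log_plus :: "real \<Rightarrow> real" where
  "log_plus x = (if x \<le> 1 then 0 else ln x)"

definition pole_count :: "(complex \<Rightarrow> complex) \<Rightarrow> real \<Rightarrow> nat" where
  "pole_count f t = (\<Sum>z\<in>{z. norm z \<le> t \<and> is_pole f z}. nat (- zorder f z))"

text \<open>At \<open>t = 0\<close> the integrand below is \<open>0 / 0 = 0\<close>, and it vanishes near \<open>0\<close>
  because the poles of a meromorphic function are isolated.\<close>

definition counting_fun :: "(complex \<Rightarrow> complex) \<Rightarrow> real \<Rightarrow> real" where
  "counting_fun f r =
     integral {0..r} (\<lambda>t. (real (pole_count f t) - real (pole_count f 0)) / t)
       + real (pole_count f 0) * ln r"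

text \<open>There may be finitely many poles on the circle itself; they do not affect the integral.\<close>

definition proximity_fun :: "(complex \<Rightarrow> complex) \<Rightarrow> real \<Rightarrow> real" where
  "proximity_fun f r =
     1 / (2 * pi) * integral {0..2*pi} (\<lambda>\<theta>. log_plus (norm (f (of_real r * cis \<theta>))))"

definition nevanlinna_char :: "(complex \<Rightarrow> complex) \<Rightarrow> real \<Rightarrow> real" where
  "nevanlinna_char f r = proximity_fun f r + counting_fun f r"

definition growth_order :: "(complex \<Rightarrow> complex) \<Rightarrow> ereal" where
  "growth_order f =
     Limsup at_top (\<lambda>r::real. ereal (log_plus (nevanlinna_char f r) / ln r))"


section \<open>The Wilson shift\<close>

text \<open>The second conjunct leaves open in which of the two half-planes the values of the
  branch lie; the third one fixes the values on the cut \<open>(-\<infinity>, 0]\<close> in either case.\<close>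

definition imag_cut_sqrt :: "(complex \<Rightarrow> complex) \<Rightarrow> bool" where
  "imag_cut_sqrt s \<longleftrightarrow>
     (\<forall>x. (s x)\<^sup>2 = x) \<and>
     ((\<forall>x. x \<notin> \<real>\<^sub>\<le>\<^sub>0 \<longrightarrow> Re (s x) > 0) \<or> (\<forall>x. x \<notin> \<real>\<^sub>\<le>\<^sub>0 \<longrightarrow> Re (s x) < 0)) \<and>
     (\<forall>t::real. t \<ge> 0 \<longrightarrow> s (of_real (- (t\<^sup>2))) = \<i> * of_real t)"

lemma imag_cut_sqrt_csqrt: "imag_cut_sqrt csqrt"
  unfolding imag_cut_sqrt_def
proof (intro conjI disjI1 allI impI)
  fix x :: complex
  assume x: "x \<notin> \<real>\<^sub>\<le>\<^sub>0"
  show "Re (csqrt x) > 0"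
  proof (rule ccontr)
    assume "\<not> Re (csqrt x) > 0"
    hence "Re (csqrt x) = 0" using csqrt_principal[of x] by blast
    hence "(csqrt x)\<^sup>2 = of_real (- ((Im (csqrt x))\<^sup>2))"
      by (simp add: complex_eq_iff power2_eq_square del: csqrt.simps power2_csqrt)
    hence "x = of_real (- ((Im (csqrt x))\<^sup>2))" by (simp only: power2_csqrt)
    hence "x \<in> \<real>\<^sub>\<le>\<^sub>0"
      by (metis neg_le_0_iff_le nonpos_Reals_of_real_iff zero_le_power2)
    thus False using x by simp
  qed
qed (simp_all add: of_real_power[symmetric] del: csqrt.simps of_real_power)

definition wilson_shift :: "(complex \<Rightarrow> complex) \<Rightarrow> complex \<Rightarrow> complex" where
  "wilson_shift s x = (s x + \<i> / 2)\<^sup>2"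

definition wilson_iter :: "(complex \<Rightarrow> complex) \<Rightarrow> nat \<Rightarrow> complex \<Rightarrow> complex" where
  "wilson_iter s m = wilson_shift s ^^ m"

text \<open>The equation is required wherever none of the values of the unknown is \<open>\<infinity>\<close>. By
  continuity off the cut (and one-sided continuity of \<open>s\<close> at the cut) this is the same as
  an identity of functions up to a discrete set of points.\<close>

definition solves_wilson_eq ::
    "(complex \<Rightarrow> complex) \<Rightarrow> nat \<Rightarrow> (nat \<Rightarrow> complex \<Rightarrow> complex) \<Rightarrow> (complex \<Rightarrow> complex) \<Rightarrow> bool" where
  "solves_wilson_eq s n A y \<longleftrightarrow>
     (\<forall>x. (\<forall>k\<le>n. \<not> is_pole y (wilson_iter s k x)) \<longrightarrow>
          (\<Sum>k\<le>n. A k x * y (wilson_iter s k x)) = 0)"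

end

theory Submission
  imports Defs "HOL-Real_Asymp.Real_Asymp"
begin

text \<open>
  Iterating the shift gives \<open>x\<^sup>+\<^sup>(\<^sup>k\<^sup>) = (z + ik/2)\<^sup>2\<close> with \<open>z = \<surd>x\<close>, so the shifted points lie within
  \<open>O(\<surd>|x|)\<close> of \<open>x\<close>. If \<open>T(r,f) \<le> r\<^sup>\<sigma>\<close> up to \<open>\<epsilon>\<close> in the exponent, the Poisson--Jensen formula on a circle of
  radius \<open>R \<approx> C|x|\<close> bounds \<open>ln |f(x\<^sup>+\<^sup>(\<^sup>k\<^sup>)) / f(x\<^sup>+\<^sup>(\<^sup>l\<^sup>))|\<close>. The Poisson kernel changes only by \<open>O(R\<^sup>-\<^sup>1\<^sup>/\<^sup>2)\<close>, and each
  zero or pole \<open>a = \<alpha>\<^sup>2\<close> contributes the logarithms \<open>ln |(z + ik/2 \<mp> \<alpha>) / (z + il/2 \<mp> \<alpha>)|\<close>, which are small on average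
  over \<open>|z| = \<rho> \<in> [P, 2P]\<close>. Hence the ratio is at most \<open>exp(|x|\<^sup>\<sigma>\<^sup>-\<^sup>1\<^sup>/\<^sup>2)\<close>, again up to \<open>\<epsilon>\<close>, on a circle in every annulus
  \<open>r \<le> |x| \<le> 4r\<close>. Solving the equation for \<open>A\<^sub>l\<close> on these circles and applying the maximum modulus
  principle bounds the order of \<open>A\<^sub>l\<close> by the maximum of \<open>\<sigma> - 1/2\<close> and the orders of the other coefficients.
\<close>

section \<open>The Poisson formula\<close>

text \<open>The maximum modulus principle needs a bound on an entire circle, so exceptional discs
  around zeros and poles cannot be tolerated. Distances are therefore bounded below by differences
  of moduli, |z + ik/2 - \<alpha>| \<ge> ||z| - b| with b = |\<alpha> - ik/2|. What has to be
  avoided is then only a set of radii, and one average over \<rho> handles all zeros, poles and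
  shifts together. The logarithms are majorised by powers |\<rho> - b|^(-q). Here q < 1 makes the
  singularity at \<rho> = b integrable, while the mean over [P, 2P] has size P^(-q), that is
  |x|^(-q/2); so q must be taken close to 1 to save almost the full exponent 1/2. In the Poisson
  term the same 1/2 arises because the squares (z + ik/2)^2 differ by O(|z|) inside a disc of radius
  comparable to |z|^2. All estimates hold for every z with |z| = \<rho>, so they cover both
  half-planes and the cut alike.\<close>

definition poisson_kernel :: "complex \<Rightarrow> complex \<Rightarrow> real" where
  "poisson_kernel w z = Re ((w + z) / (w - z))"

text \<open>The first summand is a Cauchy kernel at z, the second is holomorphic in w on the closed
  disc. On |w| = R the identity R^2 = w cnj w makes the second summand the conjugate of z / (w - z);
  since w / (w - z) and z / (w - z) differ by 1, the imaginary parts cancel.\<close>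

lemma poisson_kernel_eq:
  assumes "norm w = R" "norm z < R"
  shows "of_real (poisson_kernel w z) = w / (w - z) + cnj z * w / (of_real (R\<^sup>2) - cnj z * w)"
proof -
  have wz: "w - z \<noteq> 0" and w0: "w \<noteq> 0" using assms by auto
  have R: "of_real (R\<^sup>2) = w * cnj w"
    using assms(1) complex_norm_square by metis
  have "cnj z * w / (of_real (R\<^sup>2) - cnj z * w) = (w * cnj z) / (w * (cnj w - cnj z))"
    unfolding R by (simp add: algebra_simps)
  also have "\<dots> = cnj (z / (w - z))" using w0 by simp
  finally have *: "cnj z * w / (of_real (R\<^sup>2) - cnj z * w) = cnj (z / (w - z))" .
  have add: "(w + z) / (w - z) = w / (w - z) + z / (w - z)" by (rule add_divide_distrib)
  have "w / (w - z) - z / (w - z) = 1" using wz by (simp flip: diff_divide_distrib)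
  hence im: "Im (w / (w - z)) = Im (z / (w - z))" by (metis cancel_comm_monoid_add_class.diff_cancel
      eq_iff_diff_eq_0 minus_complex.sel(2) one_complex.sel(2))
  show ?thesis unfolding *
    unfolding complex_eq_iff poisson_kernel_def add plus_complex.sel cnj.sel im by simp
qed

text \<open>Cauchy's integral formula evaluates the first summand of
  \<open>poisson_kernel_eq\<close>; Cauchy's theorem kills the second, whose only possible pole R^2
  / cnj z lies outside the closed disc. The parametrisation contributes dw = i w dt.\<close>

lemma poisson_formula:
  assumes h: "h holomorphic_on ball 0 R'" and R: "R < R'" and z: "norm z < R"
  shows "((\<lambda>t. poisson_kernel (of_real R * cis t) z * Re (h (of_real R * cis t)))
            has_integral (2 * pi * Re (h z))) {0..2*pi}"
proof -
  have R0: "R > 0" using z by (meson norm_ge_zero order_le_less_trans)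
  have sub: "cball 0 R \<subseteq> ball 0 R'" using R by auto
  have nz: "of_real (R\<^sup>2) - cnj z * w \<noteq> 0" if "norm w \<le> R" for w
  proof
    assume "of_real (R\<^sup>2) - cnj z * w = 0"
    hence "norm (of_real (R\<^sup>2) :: complex) = norm (cnj z * w)" by simp
    hence "R\<^sup>2 = norm z * norm w" by (simp add: norm_mult norm_power)
    also have "\<dots> \<le> norm z * R" using that by (intro mult_left_mono) auto
    also have "\<dots> < R * R" using z R0 by (intro mult_strict_right_mono) auto
    finally show False by (simp add: power2_eq_square)
  qed
  have 1: "((\<lambda>w. h w / (w - z)) has_contour_integral (2 * of_real pi * \<i> * h z)) (circlepath 0 R)"
  proof (rule Cauchy_integral_circlepath)
    show "continuous_on (cball 0 R) h"
      using h sub holomorphic_on_imp_continuous_on holomorphic_on_subset by blast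
    show "h holomorphic_on ball 0 R" using h R by (auto elim: holomorphic_on_subset)
  qed (use z in auto)
  have 2: "((\<lambda>w. h w * cnj z / (of_real (R\<^sup>2) - cnj z * w)) has_contour_integral 0) (circlepath 0 R)"
  proof (rule Cauchy_theorem_convex_simple[where S = "cball 0 R"])
    show "(\<lambda>w. h w * cnj z / (of_real (R\<^sup>2) - cnj z * w)) holomorphic_on cball 0 R"
      using nz by (intro holomorphic_intros holomorphic_on_subset[OF h sub]) auto
  qed (use R0 in auto)
  have "((\<lambda>t. ((\<lambda>w. h w / (w - z)) (of_real R * cis t) * of_real R * \<i> * cis t
          + (\<lambda>w. h w * cnj z / (of_real (R\<^sup>2) - cnj z * w)) (of_real R * cis t) * of_real R * \<i> * cis t)
            / \<i>) has_integral (2 * of_real pi * \<i> * h z + 0) / \<i>) {0..2*pi}"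
    using 1 2 unfolding circlepath_def
    by (intro has_integral_divide has_integral_add)
       (auto simp: has_contour_integral_part_circlepath_iff mult_ac)
  also have "(\<lambda>t. ((\<lambda>w. h w / (w - z)) (of_real R * cis t) * of_real R * \<i> * cis t
          + (\<lambda>w. h w * cnj z / (of_real (R\<^sup>2) - cnj z * w)) (of_real R * cis t) * of_real R * \<i> * cis t)
            / \<i>) = (\<lambda>t. of_real (poisson_kernel (of_real R * cis t) z) * h (of_real R * cis t))"
  proof
    fix t
    define w where "w = of_real R * cis t"
    have w: "norm w = R" using R0 by (simp add: w_def norm_mult)
    have "(h w / (w - z) * of_real R * \<i> * cis t
          + h w * cnj z / (of_real (R\<^sup>2) - cnj z * w) * of_real R * \<i> * cis t) / \<i>
        = (w / (w - z) + cnj z * w / (of_real (R\<^sup>2) - cnj z * w)) * h w"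
      by (simp add: w_def field_simps)
    thus "((\<lambda>w. h w / (w - z)) (of_real R * cis t) * of_real R * \<i> * cis t
          + (\<lambda>w. h w * cnj z / (of_real (R\<^sup>2) - cnj z * w)) (of_real R * cis t) * of_real R * \<i> * cis t)
            / \<i> = of_real (poisson_kernel (of_real R * cis t) z) * h (of_real R * cis t)"
      using poisson_kernel_eq[OF w z] unfolding w_def by simp
  qed
  finally have "((\<lambda>t. of_real (poisson_kernel (of_real R * cis t) z) * h (of_real R * cis t))
     has_integral (2 * of_real pi * h z)) {0..2*pi}" by (simp add: algebra_simps)
  from has_integral_Re[OF this] show ?thesis by simp
qed

text \<open>A zero-free holomorphic function on a disc is exp h, and then ln |G| = Re h.\<close>

lemma poisson_formula_ln_norm:
  assumes G: "G holomorphic_on ball 0 R'" "\<And>w. w \<in> ball 0 R' \<Longrightarrow> G w \<noteq> 0"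
    and R: "R < R'" and z: "norm z < R"
  shows "((\<lambda>t. poisson_kernel (of_real R * cis t) z * ln (norm (G (of_real R * cis t))))
            has_integral (2 * pi * ln (norm (G z)))) {0..2*pi}"
proof -
  have R0: "R > 0" using z by (meson norm_ge_zero order_le_less_trans)
  obtain h where h: "h holomorphic_on ball 0 R'" and e: "\<And>w. w \<in> ball 0 R' \<Longrightarrow> exp (h w) = G w"
    using holomorphic_logarithm_exists[of "ball 0 R'" G 0] G R R0 by auto
  have ln: "ln (norm (G w)) = Re (h w)" if "norm w < R'" for w
    using e[of w] that by (metis dist_0_norm ln_exp mem_ball norm_exp_eq_Re)
  show ?thesis
    using poisson_formula[OF h R z] ln R z R0 by (simp add: norm_mult)
qed

text \<open>Harnack bounds: 3 = (1 + 1/2) / (1 - 1/2), and 1/3 is its reciprocal. The positive lower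
  bound later controls the negative part of ln |f|.\<close>

lemma poisson_kernel_bounds:
  assumes "norm w = R" "norm z \<le> R / 2" "R > 0"
  shows "poisson_kernel w z \<le> 3" "poisson_kernel w z \<ge> 1 / 3"
proof -
  have wz: "w - z \<noteq> 0" using assms by auto
  have "norm (w - z) \<ge> R / 2" using assms norm_triangle_ineq2[of w z] by simp
  have "poisson_kernel w z \<le> norm ((w + z) / (w - z))" unfolding poisson_kernel_def by (rule complex_Re_le_cmod)
  also have "\<dots> = norm (w + z) / norm (w - z)" by (simp add: norm_divide)
  also have "\<dots> \<le> (3 * R / 2) / (R / 2)"
    using assms norm_triangle_ineq[of w z] \<open>norm (w - z) \<ge> R / 2\<close> by (intro frac_le) auto
  finally show "poisson_kernel w z \<le> 3" using assms by simp
  have "(w + z) / (w - z) = (w + z) * cnj (w - z) / of_real ((norm (w - z))\<^sup>2)"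
    unfolding complex_norm_square using wz by simp
  hence "poisson_kernel w z = Re ((w + z) * cnj (w - z)) / (norm (w - z))\<^sup>2"
    unfolding poisson_kernel_def by simp
  also have "Re ((w + z) * cnj (w - z)) = (norm w)\<^sup>2 - (norm z)\<^sup>2"
    unfolding cmod_power2 by (simp add: algebra_simps power2_eq_square)
  finally have *: "poisson_kernel w z = (R\<^sup>2 - (norm z)\<^sup>2) / (norm (w - z))\<^sup>2" using assms by simp
  have "(norm (w - z))\<^sup>2 \<le> (R + norm z)\<^sup>2"
    using norm_triangle_ineq4[of w z] assms by (intro power_mono) auto
  moreover have "R\<^sup>2 - (norm z)\<^sup>2 \<ge> 0" using assms by (simp add: power2_le_iff_abs_le)
  ultimately have "poisson_kernel w z \<ge> (R\<^sup>2 - (norm z)\<^sup>2) / (R + norm z)\<^sup>2"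
    unfolding * using wz by (intro divide_left_mono mult_pos_pos) (use assms in \<open>auto intro: add_pos_nonneg\<close>)
  moreover have "(R\<^sup>2 - (norm z)\<^sup>2) / (R + norm z)\<^sup>2 = (R - norm z) / (R + norm z)"
    using assms by (simp add: power2_eq_square square_diff_square_factored add_nonneg_eq_0_iff)
  moreover have "(R - norm z) / (R + norm z) \<ge> (R/2) / (3 * R / 2)"
    using assms by (intro frac_le) (auto intro: add_pos_nonneg)
  moreover have "(R/2) / (3 * R / 2) = 1 / 3" using assms by simp
  ultimately show "poisson_kernel w z \<ge> 1 / 3" by linarith
qed

lemma poisson_kernel_diff:
  assumes "norm w = R" "norm x \<le> R / 2" "norm y \<le> R / 2" "R > 0"
  shows "\<bar>poisson_kernel w x - poisson_kernel w y\<bar> \<le> 8 * norm (x - y) / R"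
proof -
  have n: "norm (w - x) \<ge> R / 2" "norm (w - y) \<ge> R / 2"
    using assms norm_triangle_ineq2[of w x] norm_triangle_ineq2[of w y] by simp_all
  hence nz: "w - x \<noteq> 0" "w - y \<noteq> 0" using assms by auto
  have "poisson_kernel w x - poisson_kernel w y = Re ((w + x) / (w - x) - (w + y) / (w - y))"
    by (simp add: poisson_kernel_def)
  also have "(w + x) / (w - x) - (w + y) / (w - y) = 2 * w * (x - y) / ((w - x) * (w - y))"
    using nz by (simp add: field_simps)
  finally have "\<bar>poisson_kernel w x - poisson_kernel w y\<bar> \<le> norm (2 * w * (x - y) / ((w - x) * (w - y)))"
    by (metis abs_Re_le_cmod)
  also have "\<dots> = 2 * R * norm (x - y) / (norm (w - x) * norm (w - y))"
    using assms by (simp add: norm_mult norm_divide)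
  also have "\<dots> \<le> 2 * R * norm (x - y) / ((R / 2) * (R / 2))"
    using n assms by (intro divide_left_mono mult_mono mult_pos_pos) auto
  also have "\<dots> = 8 * norm (x - y) / R" using assms by (simp add: field_simps)
  finally show ?thesis .
qed

section \<open>The Poisson--Jensen formula\<close>

text \<open>The Blaschke factor of the disc of radius R: simple zero at a, modulus 1 on the boundary
  circle.\<close>

definition blaschke :: "real \<Rightarrow> complex \<Rightarrow> complex \<Rightarrow> complex" where
  "blaschke R a z = of_real R * (z - a) / (of_real (R\<^sup>2) - cnj a * z)"

lemma nicely_meromorphic_eventually_nonzero:
  assumes "f nicely_meromorphic_on UNIV" "f x \<noteq> 0"
  shows "eventually (\<lambda>w. f w \<noteq> 0) (at z)"
  using nicely_meromorphic_imp_constant_or_avoid[OF assms(1), of 0] assms(2)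
  by (auto simp: eventually_cosparse_open_eq)

lemma finite_zeros_poles:
  assumes "f nicely_meromorphic_on UNIV" "f x \<noteq> 0"
  shows "finite {z. norm z \<le> R \<and> f z = 0}"
proof -
  have "eventually (\<lambda>w. f w \<noteq> 0) (cosparse UNIV)"
    using nicely_meromorphic_eventually_nonzero[OF assms] by (simp add: eventually_cosparse_open_eq)
  hence "{z. f z = 0} sparse_in UNIV" by (simp add: eventually_cosparse)
  hence "finite (cball 0 R \<inter> {z. f z = 0})"
    by (intro sparse_in_compact_finite) (auto elim: sparse_in_subset)
  thus ?thesis by (rule rev_finite_subset) auto
qed

lemma blaschke_denom_nz:
  assumes "norm a * norm z < R\<^sup>2"
  shows "of_real (R\<^sup>2) - cnj a * z \<noteq> 0"
proof
  assume "of_real (R\<^sup>2) - cnj a * z = 0"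
  hence "norm (of_real (R\<^sup>2) :: complex) = norm (cnj a * z)" by simp
  thus False using assms by (simp add: norm_mult norm_power)
qed

lemma norm_blaschke_circle:
  assumes "norm w = R" "norm a < R"
  shows "norm (blaschke R a w) = 1"
proof -
  have "w \<noteq> 0" using assms by auto
  have "of_real (R\<^sup>2) = w * cnj w" using assms(1) complex_norm_square by metis
  hence "norm (of_real (R\<^sup>2) - cnj a * w) = norm (w * cnj (w - a))" by (simp add: algebra_simps)
  also have "\<dots> = R * norm (w - a)" using assms by (simp only: norm_mult complex_mod_cnj)
  finally have "norm (of_real (R\<^sup>2) - cnj a * w) = R * norm (w - a)" .
  moreover have "R > 0" "w - a \<noteq> 0" using assms by (auto intro: order_le_less_trans[OF norm_ge_zero])
  ultimately show ?thesis by (simp add: blaschke_def norm_divide norm_mult)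
qed

text \<open>The second hypothesis keeps z away from the reflected point R^2 / cnj a. It allows z
  slightly outside the disc, because \<open>poisson_jensen\<close> works on a neighbourhood of the
  closed disc.\<close>

lemma zorder_blaschke:
  assumes "norm a < R" "norm a * norm z < R\<^sup>2"
  shows "zorder (blaschke R a) z = (if z = a then 1 else 0)"
proof -
  define S where "S = {w :: complex. norm a * norm w < R\<^sup>2}"
  have S: "open S" unfolding S_def by (intro open_Collect_less continuous_intros)
  have R: "R > 0" using assms(1) by (meson norm_ge_zero order_le_less_trans)
  have hol: "(\<lambda>w. of_real R / (of_real (R\<^sup>2) - cnj a * w)) holomorphic_on S"
    using blaschke_denom_nz by (intro holomorphic_intros) (auto simp: S_def)
  have nz: "of_real R / (of_real (R\<^sup>2) - cnj a * z) \<noteq> 0"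
    using blaschke_denom_nz[OF assms(2)] R by simp
  show ?thesis
  proof (cases "z = a")
    case True
    have "zorder (blaschke R a) z = 1"
      by (rule zorder_eqI[OF S _ hol nz]) (use assms True in \<open>auto simp: S_def blaschke_def\<close>)
    thus ?thesis using True by simp
  next
    case False
    have "zorder (blaschke R a) z = 0"
    proof (rule zorder_eqI[where g = "blaschke R a" and S = S])
      have "(\<lambda>w. of_real R / (of_real (R\<^sup>2) - cnj a * w) * (w - a)) holomorphic_on S"
        by (intro holomorphic_intros hol)
      also have "(\<lambda>w. of_real R / (of_real (R\<^sup>2) - cnj a * w) * (w - a)) = blaschke R a"
        by (auto simp: blaschke_def)
      finally show "blaschke R a holomorphic_on S" .
      show "blaschke R a z \<noteq> 0" using nz False by (auto simp: blaschke_def)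
    qed (use S assms in \<open>auto simp: S_def\<close>)
    thus ?thesis using False by simp
  qed
qed

lemma analytic_blaschke:
  assumes "norm a * norm z < R\<^sup>2"
  shows "blaschke R a analytic_on {z}"
  unfolding blaschke_def[abs_def]
  using blaschke_denom_nz[OF assms] by (intro analytic_intros) auto

text \<open>Order 0 excludes a pole; once the singularity is filled in, a zero would be isolated and
  of positive order.\<close>

lemma remove_sings_zorder_0:
  assumes mer: "F meromorphic_on {z}" and nz: "eventually (\<lambda>w. F w \<noteq> 0) (at z)"
    and "zorder F z = 0"
  shows "remove_sings F analytic_on {z}" "remove_sings F z \<noteq> 0"
proof -
  let ?G = "remove_sings F"
  have iso: "isolated_singularity_at F z" using mer by (simp add: meromorphic_at_iff)
  have nm: "?G nicely_meromorphic_on {z}" using mer by (rule remove_sings_nicely_meromorphic)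
  have zo: "zorder ?G z = 0" using assms(3) iso by simp
  have np: "\<not> is_pole ?G z"
    using isolated_pole_imp_neg_zorder[of ?G z] iso zo by auto
  show an: "?G analytic_on {z}" using nicely_meromorphic_on_imp_analytic_at[OF nm _ np] by simp
  show "?G z \<noteq> 0"
  proof
    assume "?G z = 0"
    moreover have "eventually (\<lambda>w. ?G w \<noteq> 0) (at z)"
      using eventually_remove_sings_eq_at[OF iso] nz by eventually_elim auto
    ultimately have "isolated_zero ?G z"
      using zero_or_pole[OF nm] np by auto
    thus False using zorder_isolated_zero_pos[OF _ an] zo by auto
  qed
qed

lemma exists_slightly_larger:
  assumes "finite T" "\<And>t. t \<in> T \<Longrightarrow> (R::real) < t"
  obtains R' where "R < R'" "\<And>t. t \<in> T \<Longrightarrow> R' \<le> t"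
proof
  show "R < Min (insert (R + 1) T)" using assms by (subst Min_gr_iff) auto
  show "Min (insert (R + 1) T) \<le> t" if "t \<in> T" for t using that assms by (intro Min_le) auto
qed

lemma ln_powi: "(x::real) > 0 \<Longrightarrow> ln (x powi n) = of_int n * ln x"
  by (cases n) (auto simp: power_int_def ln_realpow ln_inverse algebra_simps)

text \<open>
  A point value \<open>f z = 0\<close> means that \<open>z\<close> is a zero or a pole, since nicely meromorphic functions
  take the value \<open>0\<close> at their poles; \<open>zorder f a\<close> is negative at the poles.
\<close>

theorem poisson_jensen:
  assumes f: "f nicely_meromorphic_on UNIV" and circ: "\<And>w. norm w = R \<Longrightarrow> f w \<noteq> 0"
    and z: "norm z < R" "f z \<noteq> 0"
  shows "((\<lambda>t. poisson_kernel (of_real R * cis t) z * ln (norm (f (of_real R * cis t)))) has_integral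
     (2 * pi * (ln (norm (f z)) -
        (\<Sum>a | norm a < R \<and> f a = 0. of_int (zorder f a) * ln (norm (blaschke R a z)))))) {0..2*pi}"
proof -
  define S where "S = {a. norm a < R \<and> f a = 0}"
  have R0: "R > 0" using z by (meson norm_ge_zero order_le_less_trans)
  have fin: "finite S" unfolding S_def
    by (rule finite_subset[OF _ finite_zeros_poles[OF f z(2), of R]]) auto
  have Sn: "norm a < R" if "a \<in> S" for a using that by (simp add: S_def)
  \<comment> \<open>Thresholds that R' must not exceed: moduli of zeros and poles outside the
    circle, the poles R^2 / |a| of the Blaschke factors, and R + 1, the cap that makes the first set
    finite.\<close>
  define T where "T = norm ` {w. norm w \<le> R + 1 \<and> f w = 0 \<and> norm w > R} \<union>
     (\<lambda>a. R\<^sup>2 / norm a) ` (S - {0}) \<union> {R + 1}"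
  have "finite T" unfolding T_def using fin
    by (auto intro!: finite_imageI intro: finite_subset[OF _ finite_zeros_poles[OF f z(2), of "R + 1"]])
  moreover have "R < R\<^sup>2 / norm a" if "a \<in> S" "a \<noteq> 0" for a
    using mult_strict_left_mono[OF Sn[OF that(1)] R0] that(2) by (simp add: field_simps power2_eq_square)
  hence "R < t" if "t \<in> T" for t
    using that unfolding T_def by auto
  ultimately obtain R' where R': "R < R'" "\<And>t. t \<in> T \<Longrightarrow> R' \<le> t"
    using exists_slightly_larger[of T R] by blast
  have fnz: "f w \<noteq> 0" if "norm w < R'" "w \<notin> S" for w
  proof
    assume w: "f w = 0"
    have "R' \<le> R + 1" by (rule R'(2)) (simp add: T_def)
    moreover have "norm w > R" using that w circ[of w] by (force simp: S_def)
    ultimately have "norm w \<in> T" using that w by (auto simp: T_def)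
    thus False using R'(2) that by force
  qed
  have aw: "norm a * norm w < R\<^sup>2" if "a \<in> S" "norm w < R'" for a w
  proof (cases "a = 0")
    case False
    hence "R\<^sup>2 / norm a \<in> T" using that by (auto simp: T_def)
    hence "norm w < R\<^sup>2 / norm a" using R'(2) that by force
    thus ?thesis using False by (simp add: field_simps)
  qed (use R0 in auto)
  \<comment> \<open>The exponents cancel every zero and pole of f in the disc, so F has order 0
    throughout the larger disc and extends to a zero-free G.\<close>
  define B where "B = (\<lambda>w. \<Prod>a\<in>S. blaschke R a w powi (- zorder f a))"
  define F where "F = (\<lambda>w. f w * B w)"
  have fmer: "f meromorphic_on A" for A
    using f by (auto simp: nicely_meromorphic_on_def elim: meromorphic_on_subset)
  have bmer: "blaschke R a meromorphic_on {w}" if "a \<in> S" "norm w < R'" for a w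
    using analytic_blaschke[OF aw[OF that]] by (rule analytic_on_imp_meromorphic_on)
  have bnz: "blaschke R a w \<noteq> 0" if "a \<in> S" "norm w < R'" "w \<noteq> a" for a w
    using blaschke_denom_nz[OF aw[OF that(1,2)]] R0 that by (simp add: blaschke_def)
  have ev: "eventually (\<lambda>v. norm v < R' \<and> v \<notin> S) (at w)" if "norm w < R'" for w
  proof -
    have "eventually (\<lambda>v. norm v < R') (at w)"
      using that by (intro order_tendstoD(2)[OF tendsto_norm[OF tendsto_ident_at]])
    moreover have "eventually (\<lambda>v. v \<notin> S) (at w)"
      using islimpt_finite[OF fin, of w] by (simp add: islimpt_conv_frequently_at frequently_def)
    ultimately show ?thesis by (rule eventually_conj)
  qed
  have BF: "B v \<noteq> 0 \<and> f v \<noteq> 0 \<and> (\<forall>a\<in>S. blaschke R a v \<noteq> 0)" if "norm v < R'" "v \<notin> S" for v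
    using that bnz fnz fin unfolding B_def by (auto simp: power_int_eq_0_iff)
  have zo: "F meromorphic_on {w} \<and> eventually (\<lambda>v. F v \<noteq> 0) (at w) \<and> zorder F w = 0"
    if w: "norm w < R'" for w
  proof (intro conjI)
    have Bm: "B meromorphic_on {w}" unfolding B_def
      by (intro meromorphic_intros bmer w)
    show "F meromorphic_on {w}" unfolding F_def by (intro meromorphic_intros fmer Bm)
    show "eventually (\<lambda>v. F v \<noteq> 0) (at w)"
      using ev[OF w] by eventually_elim (use BF in \<open>auto simp: F_def\<close>)
    have evf: "eventually (\<lambda>v. f v \<noteq> 0) (at w)" and evB: "eventually (\<lambda>v. B v \<noteq> 0) (at w)"
      and evb: "\<And>a. a \<in> S \<Longrightarrow> eventually (\<lambda>v. blaschke R a v \<noteq> 0) (at w)"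
      using ev[OF w] by (eventually_elim, use BF in blast)+
    have "zorder F w = zorder f w + zorder B w" unfolding F_def
      by (intro zorder_mult fmer Bm eventually_frequently evf evB at_neq_bot)
    also have "zorder B w = (\<Sum>a\<in>S. zorder (\<lambda>v. blaschke R a v powi (- zorder f a)) w)"
      unfolding B_def
      by (rule zorder_prod) (use evB in \<open>auto intro!: meromorphic_intros bmer w simp: B_def\<close>)
    also have "\<dots> = (\<Sum>a\<in>S. - zorder f a * (if w = a then 1 else 0))"
    proof (rule sum.cong, rule refl)
      fix a assume a: "a \<in> S"
      have "zorder (\<lambda>v. blaschke R a v powi (- zorder f a)) w = - zorder f a * zorder (blaschke R a) w"
        by (intro zorder_power_int bmer a w eventually_frequently evb at_neq_bot)
      thus "zorder (\<lambda>v. blaschke R a v powi (- zorder f a)) w = - zorder f a * (if w = a then 1 else 0)"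
        by (simp add: zorder_blaschke[OF Sn[OF a] aw[OF a w]])
    qed
    also have "\<dots> = (if w \<in> S then - zorder f w else 0)"
      using fin by (simp add: if_distrib[of "\<lambda>x. _ * x"] cong: if_cong)
    also have "zorder f w + \<dots> = 0"
    proof (cases "w \<in> S")
      case False
      have "\<not> is_pole f w" using is_pole_zero_at_nicely_mero[OF f] fnz[OF w False] by auto
      hence "f analytic_on {w}" using nicely_meromorphic_on_imp_analytic_at[OF f] by auto
      thus ?thesis using zorder_eq_0I fnz[OF w False] False by auto
    qed auto
    finally show "zorder F w = 0" .
  qed
  define G where "G = remove_sings F"
  have Gan: "G analytic_on {w}" and Gnz: "G w \<noteq> 0" if "norm w < R'" for w
    unfolding G_def using remove_sings_zorder_0[of F w] zo[OF that] by auto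
  have Ghol: "G holomorphic_on ball 0 R'"
    using Gan analytic_on_analytic_at[of G "ball 0 R'"] by (auto intro: analytic_imp_holomorphic)
  have GF: "ln (norm (G w)) = ln (norm (f w)) - (\<Sum>a\<in>S. of_int (zorder f a) * ln (norm (blaschke R a w)))"
    if w: "norm w < R'" "w \<notin> S" for w
  proof -
    have "\<not> is_pole f w" using is_pole_zero_at_nicely_mero[OF f] fnz[OF w] by auto
    hence "f analytic_on {w}" using nicely_meromorphic_on_imp_analytic_at[OF f] by auto
    hence "F analytic_on {w}" unfolding F_def B_def
      by (intro analytic_intros analytic_blaschke aw) (use w bnz in auto)
    hence "G w = F w" unfolding G_def by (rule remove_sings_at_analytic)
    hence "ln (norm (G w)) = ln (norm (f w) * (\<Prod>a\<in>S. norm (blaschke R a w) powi (- zorder f a)))"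
      by (simp add: F_def B_def norm_mult prod_norm[symmetric] norm_power_int)
    also have "\<dots> = ln (norm (f w)) + ln (\<Prod>a\<in>S. norm (blaschke R a w) powi (- zorder f a))"
      using BF[OF w] fin by (intro ln_mult_pos prod_pos) auto
    also have "ln (\<Prod>a\<in>S. norm (blaschke R a w) powi (- zorder f a)) =
        (\<Sum>a\<in>S. ln (norm (blaschke R a w) powi (- zorder f a)))"
      using BF[OF w] fin by (intro ln_prod) auto
    also have "\<dots> = (\<Sum>a\<in>S. - (of_int (zorder f a) * ln (norm (blaschke R a w))))"
      using BF[OF w] by (intro sum.cong refl) (simp add: ln_powi)
    finally show ?thesis by (simp add: sum_negf)
  qed
  have "((\<lambda>t. poisson_kernel (of_real R * cis t) z * ln (norm (G (of_real R * cis t)))) has_integral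
     (2 * pi * ln (norm (G z)))) {0..2*pi}"
    using poisson_formula_ln_norm[OF Ghol _ R'(1) z(1)] Gnz by auto
  also have "ln (norm (G z)) = ln (norm (f z)) - (\<Sum>a\<in>S. of_int (zorder f a) * ln (norm (blaschke R a z)))"
    using z R' by (intro GF) (auto simp: S_def)
  also have "(\<lambda>t. poisson_kernel (of_real R * cis t) z * ln (norm (G (of_real R * cis t)))) =
     (\<lambda>t. poisson_kernel (of_real R * cis t) z * ln (norm (f (of_real R * cis t))))"
  proof
    fix t
    have n: "norm (of_real R * cis t) = R" using R0 by (simp add: norm_mult)
    \<comment> \<open>Blaschke factors have modulus 1 on the circle, so their logarithms vanish
      there.\<close>
    have "ln (norm (G (of_real R * cis t))) = ln (norm (f (of_real R * cis t)))"
      using n Sn R' by (subst GF) (auto simp: norm_blaschke_circle[OF n] dest: Sn)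
    thus "poisson_kernel (of_real R * cis t) z * ln (norm (G (of_real R * cis t))) =
      poisson_kernel (of_real R * cis t) z * ln (norm (f (of_real R * cis t)))" by simp
  qed
  finally show ?thesis by (simp add: S_def)
qed

section \<open>Logarithmic modulus and zeros in terms of the characteristic\<close>

text \<open>Differences of the Poisson-Jensen formula weight zeros and poles alike, hence a joint
  count; the open disc is the index set of that formula.\<close>

definition zero_pole_count :: "(complex \<Rightarrow> complex) \<Rightarrow> real \<Rightarrow> real" where
  "zero_pole_count f R = (\<Sum>a | norm a < R \<and> f a = 0. \<bar>of_int (zorder f a)\<bar>)"

lemma nicely_meromorphic_analytic_at_nonzero:
  assumes "f nicely_meromorphic_on UNIV" "f z \<noteq> 0"
  shows "f analytic_on {z}"
  using assms is_pole_zero_at_nicely_mero nicely_meromorphic_on_imp_analytic_at by blast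

lemma zorder_neg_iff_is_pole:
  assumes f: "f nicely_meromorphic_on UNIV" "f x \<noteq> 0"
  shows "zorder f a < 0 \<longleftrightarrow> is_pole f a"
proof
  have mer: "f meromorphic_on {a}" using f(1) by (auto simp: nicely_meromorphic_on_def elim: meromorphic_on_subset)
  show "is_pole f a" if "zorder f a < 0"
    using zorder_neg_imp_is_pole[OF mer nicely_meromorphic_eventually_nonzero[OF f]] that by simp
  show "zorder f a < 0" if "is_pole f a"
    using isolated_pole_imp_neg_zorder[OF _ that] mer by (simp add: meromorphic_at_iff)
qed

text \<open>The positive part of the negated order gives zeros weight 0, so sums over poles and sums
  over zeros can share one index set.\<close>

lemma pole_count_eq_sum:
  assumes f: "f nicely_meromorphic_on UNIV" "f x \<noteq> 0"
  shows "real (pole_count f R) = (\<Sum>a | norm a \<le> R \<and> f a = 0. max 0 (- of_int (zorder f a)))"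
proof -
  have "real (pole_count f R) =
     (\<Sum>a | norm a \<le> R \<and> is_pole f a. max 0 (- of_int (zorder f a)))"
    unfolding pole_count_def of_nat_sum
    using zorder_neg_iff_is_pole[OF f] by (intro sum.cong refl) (auto simp: max_def)
  also have "\<dots> = (\<Sum>a | norm a \<le> R \<and> f a = 0. max 0 (- of_int (zorder f a)))"
    using finite_zeros_poles[OF f] zorder_neg_iff_is_pole[OF f] is_pole_zero_at_nicely_mero[OF f(1)]
    by (intro sum.mono_neutral_left) (auto simp: max_def order_less_le)
  finally show ?thesis .
qed

lemma sum_zeros_poles_circle:
  assumes "\<And>w. norm w = R \<Longrightarrow> f w \<noteq> 0"
  shows "{a. norm a \<le> R \<and> f a = 0} = {a::complex. norm a < R \<and> f a = 0}"
  using assms by (auto simp: order_le_less)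

lemma continuous_on_circle:
  assumes f: "f nicely_meromorphic_on UNIV" and circ: "\<And>w. norm w = R \<Longrightarrow> f w \<noteq> 0" and R: "R \<ge> 0"
  shows "continuous_on A (\<lambda>t. f (of_real R * cis t))"
proof -
  have "continuous_on (sphere 0 R) f"
    using nicely_meromorphic_analytic_at_nonzero[OF f] circ
    by (intro continuous_at_imp_continuous_on ballI analytic_at_imp_isCont) auto
  thus ?thesis
    by (rule continuous_on_compose2) (use R in \<open>auto intro!: continuous_intros simp: norm_mult\<close>)
qed

lemma log_plus_eq_max: "x > 0 \<Longrightarrow> log_plus x = max 0 (ln x)"
  by (auto simp: log_plus_def max_def)

lemma continuous_on_log_plus_norm:
  assumes "continuous_on A f"
  shows "continuous_on A (\<lambda>t. log_plus (norm (f t)))"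
proof -
  have "log_plus y = ln (max 1 y)" for y by (auto simp: log_plus_def max_def)
  thus ?thesis using assms by (auto intro!: continuous_intros)
qed

text \<open>Limits what a pole at a known distance from z can cost in the Poisson-Jensen
  formula.\<close>

lemma norm_blaschke_ge:
  assumes "norm a < R" "norm z < R"
  shows "norm (blaschke R a z) \<ge> norm (z - a) / (R + norm z)"
proof -
  have R: "R > 0" using assms by (meson norm_ge_zero order_le_less_trans)
  have lt: "norm a * norm z < R\<^sup>2" using assms R
    by (simp add: power2_eq_square mult_strict_mono)
  have "norm (of_real (R\<^sup>2) - cnj a * z) \<le> R\<^sup>2 + norm a * norm z"
    using norm_triangle_ineq4[of "of_real (R\<^sup>2)" "cnj a * z"] by (simp add: norm_mult norm_power)
  also have "\<dots> \<le> R * (R + norm z)"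
    using assms by (simp add: power2_eq_square algebra_simps mult_right_mono)
  finally have "R * norm (z - a) / norm (of_real (R\<^sup>2) - cnj a * z) \<ge> R * norm (z - a) / (R * (R + norm z))"
    using R blaschke_denom_nz[OF lt] by (intro divide_left_mono mult_pos_pos) (auto intro: add_pos_nonneg)
  thus ?thesis using R by (simp add: blaschke_def norm_mult norm_divide)
qed

lemma norm_blaschke_le_1:
  assumes "norm a < R" "norm z < R"
  shows "norm (blaschke R a z) \<le> 1"
proof -
  have R: "R > 0" using assms by (meson norm_ge_zero order_le_less_trans)
  have lt: "norm a * norm z < R\<^sup>2" using assms R
    by (simp add: power2_eq_square mult_strict_mono)
  have "(norm (of_real (R\<^sup>2) - cnj a * z))\<^sup>2 - (norm (of_real R * (z - a)))\<^sup>2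
      = (R\<^sup>2 - (norm a)\<^sup>2) * (R\<^sup>2 - (norm z)\<^sup>2)"
    unfolding cmod_power2 by (simp add: algebra_simps power2_eq_square)
  moreover have "(norm a)\<^sup>2 \<le> R\<^sup>2" "(norm z)\<^sup>2 \<le> R\<^sup>2" using assms by (auto intro!: power_mono)
  ultimately have "(norm (of_real R * (z - a)))\<^sup>2 \<le> (norm (of_real (R\<^sup>2) - cnj a * z))\<^sup>2"
    using mult_nonneg_nonneg[of "R\<^sup>2 - (norm a)\<^sup>2" "R\<^sup>2 - (norm z)\<^sup>2"] by linarith
  hence "norm (of_real R * (z - a)) \<le> norm (of_real (R\<^sup>2) - cnj a * z)"
    by (rule power2_le_imp_le) auto
  thus ?thesis unfolding blaschke_def norm_divide
    using blaschke_denom_nz[OF lt] by (simp only: divide_le_eq_1) auto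
qed

text \<open>The quotient of the two bounds is (3/8) / (31/32) = 12/31. Zeros near the centre thus
  contribute an amount bounded away from 0, which makes them countable.\<close>

lemma norm_blaschke_le_half:
  assumes "norm a \<le> R / 4" "norm z \<le> R / 8" "R > 0"
  shows "norm (blaschke R a z) \<le> 1 / 2"
proof -
  have "norm a * norm z \<le> R / 4 * (R / 8)" using assms by (intro mult_mono) auto
  hence "R\<^sup>2 - norm a * norm z \<ge> 31 / 32 * R\<^sup>2" by (simp add: power2_eq_square)
  moreover have "norm (of_real (R\<^sup>2) - cnj a * z) \<ge> R\<^sup>2 - norm a * norm z"
    using norm_triangle_ineq2[of "of_real (R\<^sup>2)" "cnj a * z"] by (simp add: norm_mult norm_power)
  ultimately have d: "norm (of_real (R\<^sup>2) - cnj a * z) \<ge> 31 / 32 * R\<^sup>2" by linarith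
  have "norm (z - a) \<le> 3 / 8 * R" using norm_triangle_ineq4[of z a] assms by simp
  hence "R * norm (z - a) \<le> R * (3 / 8 * R)" using assms by (intro mult_left_mono) auto
  moreover have "R\<^sup>2 > 0" using assms by simp
  ultimately have "R * norm (z - a) \<le> 1 / 2 * norm (of_real (R\<^sup>2) - cnj a * z)"
    using d by (simp add: power2_eq_square)
  moreover have "norm (of_real (R\<^sup>2) - cnj a * z) > 0" using d \<open>R\<^sup>2 > 0\<close> by linarith
  ultimately show ?thesis using assms unfolding blaschke_def norm_mult norm_divide norm_of_real
    by (subst pos_divide_le_eq) auto
qed

text \<open>
  Evaluating the Poisson--Jensen formula at the fixed point \<open>z0\<close> plays the role of Jensen's formula
  at \<open>0\<close>, where \<open>f\<close> may have a zero or a pole. Each pole costs at most \<open>2 ln R\<close>, which is affordable here.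
\<close>

lemma log_modulus_and_zero_count_bound:
  assumes f: "f nicely_meromorphic_on UNIV" "f z0 \<noteq> 0"
  obtains K R0 where "K > 0" "R0 \<ge> 1"
    "\<And>R V. R \<ge> R0 \<Longrightarrow> (\<And>w. norm w = R \<Longrightarrow> f w \<noteq> 0) \<Longrightarrow>
       V = proximity_fun f R + real (pole_count f R) * ln R \<Longrightarrow>
       integral {0..2*pi} (\<lambda>t. \<bar>ln (norm (f (of_real R * cis t)))\<bar>) \<le> K * (1 + V) \<and>
       zero_pole_count f (R / 4) \<le> K * (1 + V)"
proof -
  have "isCont f z0"
    using nicely_meromorphic_analytic_at_nonzero[OF f] analytic_at_imp_isCont by blast
  then obtain d where d: "d > 0" "\<And>b. norm (z0 - b) < d \<Longrightarrow> f b \<noteq> 0"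
    using f(2) continuous_at_avoid[of z0 f 0] by (metis dist_norm)
  define c where "c = \<bar>ln (norm (f z0))\<bar>"
  \<comment> \<open>Chosen to dominate every coefficient in the two final estimates, with
    slack.\<close>
  define K where "K = 1 + 6 * pi * c + 20 * pi + 12 * pi + 40"
  \<comment> \<open>The summands secure |z0| \<le> R/8, 2/d \<le> R and ln R \<ge> 1. The second
    yields the cost 2 ln R per pole, as poles keep distance d from z0.\<close>
  define R0 where "R0 = 1 + 8 * norm z0 + 2 / d + exp 1"
  have c0: "c \<ge> 0" by (simp add: c_def)
  show ?thesis
  proof (rule that[of K R0])
    show "K > 0" unfolding K_def using c0 by (intro add_nonneg_pos add_nonneg_nonneg) auto
    show "R0 \<ge> 1" unfolding R0_def using d by simp
  next
    fix R V assume R: "R \<ge> R0" and circ: "\<And>w. norm w = R \<Longrightarrow> f w \<noteq> 0"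
      and V: "V = proximity_fun f R + real (pole_count f R) * ln R"
    have R1: "R \<ge> 1" "norm z0 \<le> R / 8" "2 / d \<le> R" "exp 1 \<le> R"
    proof -
      have "2 / d \<ge> 0" "exp 1 \<ge> (0::real)" "norm z0 \<ge> 0" using d by auto
      thus "R \<ge> 1" "norm z0 \<le> R / 8" "2 / d \<le> R" "exp 1 \<le> R" using R unfolding R0_def by linarith+
    qed
    have lnR: "ln R \<ge> 1" using R1 by (simp add: ln_ge_iff)
    define S where "S = {a. norm a < R \<and> f a = 0}"
    have fin: "finite S" unfolding S_def
      by (rule finite_subset[OF _ finite_zeros_poles[OF f, of R]]) auto
    define u where "u = (\<lambda>t. ln (norm (f (of_real R * cis t))))"
    define k where "k = (\<lambda>t. poisson_kernel (of_real R * cis t) z0)"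
    define m where "m = integral {0..2*pi} (\<lambda>t. max 0 (u t))"
    define um where "um = integral {0..2*pi} (\<lambda>t. max 0 (- u t))"
    define p where "p = real (pole_count f R)"
    define b where "b = (\<lambda>a. - ln (norm (blaschke R a z0)))"
    define ZZ where "ZZ = (\<Sum>a\<in>S. max 0 (of_int (zorder f a)) * b a)"
    define PP where "PP = (\<Sum>a\<in>S. max 0 (- of_int (zorder f a)) * b a)"
    have nw: "norm (of_real R * cis t) = R" for t using R1 by (simp add: norm_mult)
    have ucont: "continuous_on {0..2*pi} u"
      unfolding u_def using nw circ R1
      by (intro continuous_intros continuous_on_circle[OF f(1)]) auto
    have fpos: "norm (f (of_real R * cis t)) > 0" for t using circ[OF nw] by simp
    have mprox: "m = 2 * pi * proximity_fun f R"
      unfolding m_def proximity_fun_def u_def using log_plus_eq_max[OF fpos] by simp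
    have p_eq: "p = (\<Sum>a\<in>S. max 0 (- of_int (zorder f a)))"
      using sum_zeros_poles_circle[of R f] circ by (simp add: p_def pole_count_eq_sum[OF f] S_def)
    have p0: "p \<ge> 0" by (simp add: p_def)
    have z0R: "norm z0 < R" using R1 by linarith
    have b0: "b a \<ge> 0" if "a \<in> S" for a
    proof -
      have "norm (blaschke R a z0) \<le> 1" using that z0R by (intro norm_blaschke_le_1) (auto simp: S_def)
      thus ?thesis by (cases "blaschke R a z0 = 0") (auto simp: b_def)
    qed
    have bu: "b a \<le> 2 * ln R" if "a \<in> S" for a
    proof -
      have za: "norm (z0 - a) \<ge> d" using d(2)[of a] that by (auto simp: S_def not_less[symmetric])
      have "1 / R\<^sup>2 \<le> d / (2 * R)" using R1 d by (simp add: field_simps power2_eq_square)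
      also have "\<dots> \<le> norm (z0 - a) / (R + norm z0)" using za R1 d
        by (intro frac_le add_pos_nonneg) auto
      also have "\<dots> \<le> norm (blaschke R a z0)" using that z0R by (intro norm_blaschke_ge) (auto simp: S_def)
      finally have "ln (1 / R\<^sup>2) \<le> ln (norm (blaschke R a z0))" using R1
        by (subst ln_le_cancel_iff) (auto intro: less_le_trans[of 0 "1 / R\<^sup>2"])
      thus ?thesis using R1 by (simp add: b_def ln_div ln_realpow)
    qed
    have ZZ0: "ZZ \<ge> 0" unfolding ZZ_def using b0 by (intro sum_nonneg mult_nonneg_nonneg) auto
    have PP: "PP \<le> p * (2 * ln R)" unfolding PP_def p_eq sum_distrib_right
      using bu by (intro sum_mono mult_left_mono) auto
    have "(\<Sum>a\<in>S. of_int (zorder f a) * ln (norm (blaschke R a z0))) = PP - ZZ"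
      unfolding PP_def ZZ_def sum_subtractf[symmetric] b_def
      by (intro sum.cong refl) (auto simp: max_def)
    hence PJ: "((\<lambda>t. k t * u t) has_integral (2 * pi * (ln (norm (f z0)) - (PP - ZZ)))) {0..2*pi}"
      using poisson_jensen[OF f(1) circ z0R f(2)] unfolding S_def k_def u_def by simp
    have int: "(\<lambda>t. max 0 (u t)) integrable_on {0..2*pi}" "(\<lambda>t. max 0 (- u t)) integrable_on {0..2*pi}"
      by (intro integrable_continuous_real continuous_intros ucont)+
    \<comment> \<open>The kernel is bounded by 3 where u is positive and by 1/3 from below where u
      is negative.\<close>
    hence "((\<lambda>t. max 0 (u t) * 3 - max 0 (- u t) * (1/3)) has_integral (m * 3 - um * (1/3))) {0..2*pi}"
      unfolding m_def um_def by (intro has_integral_diff has_integral_mult_left integrable_integral)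
    hence "2 * pi * (ln (norm (f z0)) - (PP - ZZ)) \<le> m * 3 - um * (1/3)"
    proof (rule has_integral_le[OF PJ])
      fix t
      have kb: "k t \<le> 3" "k t \<ge> 1/3" unfolding k_def
        using poisson_kernel_bounds[OF nw, of z0 t] R1 by auto
      show "k t * u t \<le> max 0 (u t) * 3 - max 0 (- u t) * (1/3)"
      proof (cases "u t \<ge> 0")
        case True
        thus ?thesis using mult_right_mono[OF kb(1) True] by simp
      next
        case False
        hence "k t * u t \<le> 1/3 * u t" using kb by (intro mult_right_mono_neg) auto
        thus ?thesis using False by simp
      qed
    qed
    moreover have "ln (norm (f z0)) \<ge> - c" by (simp add: c_def)
    hence "2 * pi * ln (norm (f z0)) \<ge> 2 * pi * (- c)" by (intro mult_left_mono) auto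
    moreover have "2 * pi * PP \<le> 2 * pi * (p * (2 * ln R))" using PP by (intro mult_left_mono) auto
    \<comment> \<open>The negative part of ln |f| and the zeros stand on the left, both nonnegative,
      so this one inequality bounds each of them.\<close>
    ultimately have main: "um / 3 + 2 * pi * ZZ \<le> 3 * m + 4 * pi * (p * ln R) + 2 * pi * c"
      unfolding right_diff_distrib by linarith
    have um0: "um \<ge> 0" unfolding um_def by (intro integral_nonneg int) auto
    have m0: "m \<ge> 0" unfolding m_def by (intro integral_nonneg int) auto
    have prox0: "proximity_fun f R \<ge> 0" using m0 mprox pi_gt_zero by (simp add: zero_le_mult_iff not_le[symmetric])
    have plnR: "0 \<le> p * ln R" using p0 lnR by simp
    have V': "V = proximity_fun f R + p * ln R" by (simp add: V p_def)
    have "integral {0..2*pi} (\<lambda>t. \<bar>u t\<bar>) = integral {0..2*pi} (\<lambda>t. max 0 (u t) + max 0 (- u t))"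
      by (intro integral_cong) (auto simp: max_def)
    also have "\<dots> = m + um" unfolding m_def um_def by (intro integral_add int)
    also have "\<dots> \<le> 10 * m + 12 * pi * (p * ln R) + 6 * pi * c"
    proof -
      have "2 * pi * ZZ \<ge> 0" using ZZ0 by simp
      thus ?thesis using main by linarith
    qed
    also have "\<dots> = 20 * pi * proximity_fun f R + 12 * pi * (p * ln R) + 6 * pi * c"
      by (simp add: mprox)
    also have "\<dots> \<le> K * proximity_fun f R + K * (p * ln R) + K * 1"
      using prox0 plnR c0 unfolding K_def by (intro add_mono mult_right_mono) auto
    also have "\<dots> = K * (1 + V)" by (simp add: V' algebra_simps)
    finally have 1: "integral {0..2*pi} (\<lambda>t. \<bar>u t\<bar>) \<le> K * (1 + V)" .
    have "zero_pole_count f (R / 4) =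
       (\<Sum>a | norm a < R / 4 \<and> f a = 0. max 0 (of_int (zorder f a)) + max 0 (- of_int (zorder f a)))"
      unfolding zero_pole_count_def by (intro sum.cong refl) (auto simp: max_def)
    also have "\<dots> = (\<Sum>a | norm a < R / 4 \<and> f a = 0. max 0 (of_int (zorder f a))) +
       (\<Sum>a | norm a < R / 4 \<and> f a = 0. max 0 (- of_int (zorder f a)))" by (rule sum.distrib)
    also have "(\<Sum>a | norm a < R / 4 \<and> f a = 0. max 0 (- of_int (zorder f a))) \<le> p"
      unfolding p_eq using fin R1 by (intro sum_mono2) (auto simp: S_def)
    also have "(\<Sum>a | norm a < R / 4 \<and> f a = 0. max 0 (of_int (zorder f a))) \<le>
        (\<Sum>a | norm a < R / 4 \<and> f a = 0. max 0 (of_int (zorder f a)) * (2 * b a))"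
    proof (rule sum_mono)
      fix a assume a: "a \<in> {a. norm a < R / 4 \<and> f a = 0}"
      have "norm (blaschke R a z0) \<le> 1 / 2" using a R1 by (intro norm_blaschke_le_half) auto
      moreover have "blaschke R a z0 \<noteq> 0"
      proof -
        have "norm (blaschke R a z0) \<ge> norm (z0 - a) / (R + norm z0)"
          using a R1 by (intro norm_blaschke_ge) auto
        moreover have "norm (z0 - a) / (R + norm z0) > 0" using a f(2) R1
          by (intro divide_pos_pos add_pos_nonneg) auto
        ultimately show ?thesis by auto
      qed
      ultimately have "ln (norm (blaschke R a z0)) \<le> ln (1/2)" by (subst ln_le_cancel_iff) auto
      \<comment> \<open>Hence b a \<ge> 1/2, and 2 * ZZ counts each zero of the small disc at least
        once.\<close>
      moreover have "ln (1/2) \<le> (1/2 - 1 :: real)" by (rule ln_le_minus_one) auto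
      ultimately have "1 \<le> 2 * b a" by (simp add: b_def)
      thus "max 0 (of_int (zorder f a)) \<le> max 0 (of_int (zorder f a)) * (2 * b a)"
        using mult_left_mono[of 1 "2 * b a" "max 0 (of_int (zorder f a))"] by simp
    qed
    also have "\<dots> \<le> (\<Sum>a\<in>S. max 0 (of_int (zorder f a)) * (2 * b a))"
      using fin R1 b0 by (intro sum_mono2) (auto simp: S_def)
    also have "\<dots> = 2 * ZZ" unfolding ZZ_def sum_distrib_left by (intro sum.cong) auto
    also have "2 * ZZ \<le> 2 * pi * ZZ" using ZZ0 pi_gt3 by (intro mult_right_mono) auto
    also have "\<dots> \<le> 3 * m + 4 * pi * (p * ln R) + 2 * pi * c" using main um0 by linarith
    finally have "zero_pole_count f (R / 4) \<le> 3 * m + 4 * pi * (p * ln R) + 2 * pi * c + p" by simp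
    also have "\<dots> \<le> 3 * m + 4 * pi * (p * ln R) + 2 * pi * c + p * ln R"
      using mult_left_mono[OF lnR p0] by simp
    also have "\<dots> = 6 * pi * proximity_fun f R + (4 * pi + 1) * (p * ln R) + 2 * pi * c"
      by (simp add: mprox algebra_simps)
    also have "\<dots> \<le> K * proximity_fun f R + K * (p * ln R) + K * 1"
      using prox0 plnR c0 unfolding K_def by (intro add_mono mult_right_mono) auto
    also have "\<dots> = K * (1 + V)" by (simp add: V' algebra_simps)
    finally have 2: "zero_pole_count f (R / 4) \<le> K * (1 + V)" by simp
    show "integral {0..2*pi} (\<lambda>t. \<bar>ln (norm (f (of_real R * cis t)))\<bar>) \<le> K * (1 + V) \<and>
       zero_pole_count f (R / 4) \<le> K * (1 + V)" using 1 2 by (simp add: u_def)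
  qed
qed

section \<open>The integrated counting function as a logarithmic sum over poles\<close>

text \<open>A pole at the origin has weight ln R instead of ln (R / |a|) and is split off.\<close>

lemma pole_count_split:
  assumes f: "f nicely_meromorphic_on UNIV" "f x \<noteq> 0" and r: "r \<ge> 0"
  shows "real (pole_count f r) = real (pole_count f 0) +
    (\<Sum>a | norm a \<le> r \<and> a \<noteq> 0 \<and> f a = 0. max 0 (- of_int (zorder f a)))"
proof -
  have "{a. norm a \<le> r \<and> f a = 0} = {a. norm a \<le> 0 \<and> f a = 0} \<union> {a. norm a \<le> r \<and> a \<noteq> 0 \<and> f a = 0}"
    using r by auto
  thus ?thesis unfolding pole_count_eq_sum[OF f]
    by (simp only:) (rule sum.union_disjoint, auto intro: finite_subset[OF _ finite_zeros_poles[OF f, of r]]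
       finite_subset[OF _ finite_zeros_poles[OF f, of 0]])
qed

text \<open>A pole of modulus b adds 1 / t to the integrand of \<open>counting_fun\<close> from t =
  b on.\<close>

lemma has_integral_inverse_tail:
  assumes "0 < b" "b \<le> (R::real)"
  shows "((\<lambda>t. if b \<le> t then 1 / t else 0) has_integral ln (R / b)) {0..R}"
proof -
  have "((\<lambda>t. 1 / t) has_integral (ln R - ln b)) {b..R}"
    using assms by (intro fundamental_theorem_of_calculus)
      (auto intro!: derivative_eq_intros simp: has_real_derivative_iff_has_vector_derivative[symmetric])
  hence "((\<lambda>t. if t \<in> {b..R} then 1 / t else 0) has_integral (ln R - ln b)) {0..R}"
    using assms by (subst has_integral_restrict) auto
  moreover have "ln R - ln b = ln (R / b)" using assms by (simp add: ln_div)
  ultimately show ?thesis by (auto elim!: has_integral_eq[rotated])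
qed

lemma counting_fun_eq:
  assumes f: "f nicely_meromorphic_on UNIV" "f x \<noteq> 0" and R: "R \<ge> 0"
  shows "counting_fun f R = (\<Sum>a | norm a \<le> R \<and> a \<noteq> 0 \<and> f a = 0. max 0 (- of_int (zorder f a)) * ln (R / norm a))
     + real (pole_count f 0) * ln R"
proof -
  define A where "A = {a. norm a \<le> R \<and> a \<noteq> 0 \<and> f a = 0}"
  have fin: "finite A" unfolding A_def
    by (rule finite_subset[OF _ finite_zeros_poles[OF f, of R]]) auto
  have "((\<lambda>t. \<Sum>a\<in>A. max 0 (- of_int (zorder f a)) * (if norm a \<le> t then 1 / t else 0)) has_integral
     (\<Sum>a\<in>A. max 0 (- of_int (zorder f a)) * ln (R / norm a))) {0..R}"
    using fin by (intro has_integral_sum has_integral_mult_right has_integral_inverse_tail) (auto simp: A_def)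
  also have "?this \<longleftrightarrow> ((\<lambda>t. (real (pole_count f t) - real (pole_count f 0)) / t) has_integral
     (\<Sum>a\<in>A. max 0 (- of_int (zorder f a)) * ln (R / norm a))) {0..R}"
  proof (rule has_integral_cong)
    fix t assume t: "t \<in> {0..R}"
    have "(\<Sum>a\<in>A. max 0 (- of_int (zorder f a)) * (if norm a \<le> t then 1 / t else 0)) =
       (\<Sum>a\<in>A. if norm a \<le> t then max 0 (- of_int (zorder f a)) / t else 0)"
      by (intro sum.cong) auto
    also have "\<dots> = (\<Sum>a | norm a \<le> t \<and> a \<noteq> 0 \<and> f a = 0. max 0 (- of_int (zorder f a)) / t)"
      using fin t by (subst sum.inter_filter[symmetric]) (auto intro!: sum.cong simp: A_def)
    also have "\<dots> = (real (pole_count f t) - real (pole_count f 0)) / t"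
      using t by (simp add: pole_count_split[OF f, of t] sum_divide_distrib)
    finally show "(\<Sum>a\<in>A. max 0 (- of_int (zorder f a)) * (if norm a \<le> t then 1 / t else 0)) =
      (real (pole_count f t) - real (pole_count f 0)) / t" .
  qed
  finally show ?thesis unfolding counting_fun_def A_def by (simp add: integral_unique)
qed

lemma counting_fun_nonneg:
  assumes f: "f nicely_meromorphic_on UNIV" "f x \<noteq> 0" and R: "R \<ge> 1"
  shows "counting_fun f R \<ge> 0"
  unfolding counting_fun_eq[OF f order.trans[OF zero_le_one R]] using R
  by (intro add_nonneg_nonneg sum_nonneg mult_nonneg_nonneg) auto

text \<open>A nonzero pole with |a| \<le> R has weight ln (2R / |a|) \<ge> ln 2 at radius 2R; for a
  pole at 0 the weight is ln (2R), where R \<ge> 1 is used.\<close>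

lemma pole_count_le_counting_fun:
  assumes f: "f nicely_meromorphic_on UNIV" "f x \<noteq> 0" and R: "R \<ge> 1"
  shows "real (pole_count f R) * ln 2 \<le> counting_fun f (2 * R)"
proof -
  have "real (pole_count f R) * ln 2 =
    (\<Sum>a | norm a \<le> R \<and> a \<noteq> 0 \<and> f a = 0. max 0 (- of_int (zorder f a)) * ln 2) + real (pole_count f 0) * ln 2"
    using R by (simp add: pole_count_split[OF f, of R] distrib_right sum_distrib_right)
  also have "\<dots> \<le> (\<Sum>a | norm a \<le> R \<and> a \<noteq> 0 \<and> f a = 0. max 0 (- of_int (zorder f a)) * ln (2 * R / norm a))
     + real (pole_count f 0) * ln (2 * R)"
    using R by (intro add_mono sum_mono mult_left_mono ln_mono) (auto simp: le_divide_eq)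
  also have "\<dots> \<le> (\<Sum>a | norm a \<le> 2 * R \<and> a \<noteq> 0 \<and> f a = 0. max 0 (- of_int (zorder f a)) * ln (2 * R / norm a))
     + real (pole_count f 0) * ln (2 * R)"
    using R by (intro add_right_mono sum_mono2 mult_nonneg_nonneg
         finite_subset[OF _ finite_zeros_poles[OF f, of "2 * R"]]) auto
  also have "\<dots> = counting_fun f (2 * R)" using R by (subst counting_fun_eq[OF f]) auto
  finally show ?thesis .
qed

text \<open>A non-integrable function has integral 0 by convention, so \<open>proximity_fun\<close>
  is nonnegative on every circle.\<close>

lemma integral_nonneg_total: "(\<And>t. t \<in> A \<Longrightarrow> f t \<ge> 0) \<Longrightarrow> integral A f \<ge> (0::real)"
  by (cases "f integrable_on A") (auto intro: integral_nonneg simp: not_integrable_integral)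

lemma log_plus_nonneg: "log_plus x \<ge> 0"
  by (simp add: log_plus_def)

lemma proximity_fun_nonneg: "proximity_fun f R \<ge> 0"
  unfolding proximity_fun_def by (intro mult_nonneg_nonneg integral_nonneg_total) (auto simp: log_plus_nonneg)

text \<open>The gap between \<tau> and \<tau>' absorbs the constant and the factor ln R per pole.
  The characteristic at 2R enters because it controls the number of poles up to R.\<close>

lemma growth_of_log_modulus_and_zeros:
  assumes f: "f nicely_meromorphic_on UNIV" "f x \<noteq> 0" and \<tau>: "0 < \<tau>" "\<tau> < \<tau>'"
    and T: "eventually (\<lambda>r. nevanlinna_char f r \<le> r powr \<tau>) at_top"
  shows "eventually (\<lambda>R. (\<forall>w. norm w = R \<longrightarrow> f w \<noteq> 0) \<longrightarrow>
       integral {0..2*pi} (\<lambda>t. \<bar>ln (norm (f (of_real R * cis t)))\<bar>) \<le> R powr \<tau>' \<and>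
       zero_pole_count f (R / 4) \<le> R powr \<tau>') at_top"
proof -
  obtain K R0 where K: "K > 0" "R0 \<ge> 1"
    and KR: "\<And>R V. R \<ge> R0 \<Longrightarrow> (\<And>w. norm w = R \<Longrightarrow> f w \<noteq> 0) \<Longrightarrow>
       V = proximity_fun f R + real (pole_count f R) * ln R \<Longrightarrow>
       integral {0..2*pi} (\<lambda>t. \<bar>ln (norm (f (of_real R * cis t)))\<bar>) \<le> K * (1 + V) \<and>
       zero_pole_count f (R / 4) \<le> K * (1 + V)"
    using log_modulus_and_zero_count_bound[OF f] by metis
  have "eventually (\<lambda>R::real. K * (1 + (R powr \<tau> + (2 * R) powr \<tau> / ln 2 * ln R)) \<le> R powr \<tau>') at_top"
    using K \<tau> by real_asymp
  moreover have "filterlim (\<lambda>R::real. 2 * R) at_top at_top" by real_asymp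
  hence "eventually (\<lambda>R. nevanlinna_char f (2 * R) \<le> (2 * R) powr \<tau>) at_top"
    by (rule eventually_compose_filterlim[OF T])
  moreover have "eventually (\<lambda>R. R \<ge> R0) at_top" by (rule eventually_ge_at_top)
  ultimately show ?thesis using T
  proof eventually_elim
    case (elim R)
    have R: "R \<ge> 1" using elim K by linarith
    define V where "V = proximity_fun f R + real (pole_count f R) * ln R"
    have p: "proximity_fun f R \<le> R powr \<tau>"
      using elim counting_fun_nonneg[OF f R] by (simp add: nevanlinna_char_def)
    have "real (pole_count f R) * ln 2 \<le> (2 * R) powr \<tau>"
      using elim pole_count_le_counting_fun[OF f R] proximity_fun_nonneg[of f "2 * R"] by (simp add: nevanlinna_char_def)
    hence "real (pole_count f R) \<le> (2 * R) powr \<tau> / ln 2" by (simp add: field_simps)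
    hence "real (pole_count f R) * ln R \<le> (2 * R) powr \<tau> / ln 2 * ln R"
      using R by (intro mult_right_mono) auto
    hence "V \<le> R powr \<tau> + (2 * R) powr \<tau> / ln 2 * ln R" using p by (simp add: V_def)
    hence "K * (1 + V) \<le> K * (1 + (R powr \<tau> + (2 * R) powr \<tau> / ln 2 * ln R))"
      using K by (intro mult_left_mono) auto
    hence "K * (1 + V) \<le> R powr \<tau>'" using elim by linarith
    thus ?case using KR[of R V] elim unfolding V_def by force
  qed
qed

lemma exists_zero_free_circle:
  assumes f: "f nicely_meromorphic_on UNIV" "f x \<noteq> 0" and r: "r < r'"
  obtains R where "r \<le> R" "R \<le> r'" "\<And>w. norm w = R \<Longrightarrow> f w \<noteq> 0"
proof -
  have "finite (norm ` {z. norm z \<le> r' \<and> f z = 0})" using finite_zeros_poles[OF f] by simp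
  hence "\<not> {r..r'} \<subseteq> norm ` {z. norm z \<le> r' \<and> f z = 0}"
    using infinite_Icc[OF r] finite_subset by blast
  then obtain R where "R \<in> {r..r'}" "R \<notin> norm ` {z. norm z \<le> r' \<and> f z = 0}" by blast
  thus ?thesis using that[of R] by auto
qed

lemma zero_pole_count_mono:
  assumes f: "f nicely_meromorphic_on UNIV" "f x \<noteq> 0" and r: "r \<le> r'"
  shows "zero_pole_count f r \<le> zero_pole_count f r'"
  unfolding zero_pole_count_def using r
  by (intro sum_mono2 finite_subset[OF _ finite_zeros_poles[OF f, of r']]) auto

text \<open>Monotonicity of the count frees the bound from the condition on the circle: a suitable R
  exists between 4r and 5r, and the intermediate exponent \<mu> pays for the factor 5.\<close>

lemma growth_of_zeros:
  assumes f: "f nicely_meromorphic_on UNIV" "f x \<noteq> 0" and \<tau>: "0 < \<tau>" "\<tau> < \<tau>'"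
    and T: "eventually (\<lambda>r. nevanlinna_char f r \<le> r powr \<tau>) at_top"
  shows "eventually (\<lambda>r. zero_pole_count f r \<le> r powr \<tau>') at_top"
proof -
  define \<mu> where "\<mu> = (\<tau> + \<tau>') / 2"
  have \<mu>: "\<tau> < \<mu>" "\<mu> < \<tau>'" "0 < \<mu>" using \<tau> by (auto simp: \<mu>_def)
  obtain R0 where R0: "\<And>R. R \<ge> R0 \<Longrightarrow> (\<forall>w. norm w = R \<longrightarrow> f w \<noteq> 0) \<longrightarrow> zero_pole_count f (R / 4) \<le> R powr \<mu>"
    using growth_of_log_modulus_and_zeros[OF f \<tau>(1) \<mu>(1) T] unfolding eventually_at_top_linorder by blast
  have "eventually (\<lambda>r::real. (5 * r) powr \<mu> \<le> r powr \<tau>') at_top" using \<mu> by real_asymp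
  moreover have "eventually (\<lambda>r. r \<ge> max 1 R0) at_top" by (rule eventually_ge_at_top)
  ultimately show ?thesis
  proof eventually_elim
    case (elim r)
    obtain R where R: "4 * r \<le> R" "R \<le> 5 * r" "\<And>w. norm w = R \<Longrightarrow> f w \<noteq> 0"
      using exists_zero_free_circle[OF f, of "4 * r" "5 * r"] elim by auto
    have "zero_pole_count f r \<le> zero_pole_count f (R / 4)" using R by (intro zero_pole_count_mono[OF f]) auto
    also have "\<dots> \<le> R powr \<mu>" using R0[of R] R elim by auto
    also have "\<dots> \<le> (5 * r) powr \<mu>" using R elim \<mu> by (intro powr_mono2) auto
    finally show ?case using elim by linarith
  qed
qed

section \<open>Logarithmic differences\<close>

text \<open>Trades the logarithm for a power that can be averaged. For t \<le> 1 it rests on t \<le>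
  t^q, for t > 1 on ln t \<le> t^q / q.\<close>

lemma ln_1_plus_le_powr:
  fixes t q :: real
  assumes "t \<ge> 0" "0 < q" "q \<le> 1"
  shows "ln (1 + t) \<le> 2 / q * t powr q"
proof (cases "t \<le> 1")
  case True
  have "ln (1 + t) \<le> t" using assms by (intro ln_add_one_self_le_self) auto
  also have "t \<le> t powr q"
  proof (cases "t = 0")
    case False
    thus ?thesis using True assms powr_mono'[of q 1 t] by simp
  qed auto
  also have "\<dots> \<le> 2 / q * t powr q" using assms mult_right_mono[of 1 "2 / q" "t powr q"] by simp
  finally show ?thesis .
next
  case False
  have "ln (1 + t) \<le> ln (2 * t)" using False by (subst ln_le_cancel_iff) auto
  also have "\<dots> = ln 2 + ln t" using False by (simp add: ln_mult)
  also have "ln 2 \<le> (2 - 1 :: real)" by (rule ln_le_minus_one) auto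
  also have "2 - 1 \<le> t powr q" using False assms by (simp add: ge_one_powr_ge_zero)
  also have "ln t \<le> t powr q / q"
    using ln_powr_bound[of t q] False assms by simp
  also have "t powr q + t powr q / q \<le> 2 / q * t powr q"
    using assms mult_right_mono[of q 1 "t powr q"] by (simp add: field_simps)
  finally show ?thesis by simp
qed

lemma abs_diff_ln_norm_le:
  fixes u v :: complex
  assumes "u \<noteq> 0" "v \<noteq> 0" "norm (u - v) \<le> d"
  shows "\<bar>ln (norm u) - ln (norm v)\<bar> \<le> ln (1 + d / norm u) + ln (1 + d / norm v)"
proof -
  have d: "d \<ge> 0" using assms(3) norm_ge_zero order_trans by blast
  have *: "ln (norm u) - ln (norm v) \<le> ln (1 + d / norm v)"
    if "u \<noteq> 0" "v \<noteq> 0" "norm (u - v) \<le> d" for u v :: complex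
  proof -
    have "norm u \<le> norm v + d" using norm_triangle_sub[of u v] that by linarith
    hence "norm u / norm v \<le> 1 + d / norm v" using that by (simp add: field_simps)
    hence "ln (norm u / norm v) \<le> ln (1 + d / norm v)" using that by (intro ln_mono) auto
    thus ?thesis using that by (simp add: ln_div)
  qed
  have "0 \<le> ln (1 + d / norm u)" "0 \<le> ln (1 + d / norm v)" using d by auto
  thus ?thesis using *[OF assms] *[of v u] assms by (auto simp: norm_minus_commute abs_le_iff)
qed

text \<open>The numerator of the Blaschke factor gives the difference of logarithms. The denominator
  is at least R^2 / 2 in modulus and Lipschitz with constant R, which costs 2 |x - y| / R.\<close>

lemma ln_norm_blaschke_diff:
  assumes a: "norm a < R" and x: "norm x \<le> R / 2" "x \<noteq> a" and y: "norm y \<le> R / 2" "y \<noteq> a"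
  shows "\<bar>ln (norm (blaschke R a x)) - ln (norm (blaschke R a y))\<bar>
     \<le> \<bar>ln (norm (x - a)) - ln (norm (y - a))\<bar> + 2 * norm (x - y) / R"
proof -
  have R: "R > 0" using a by (meson norm_ge_zero order_le_less_trans)
  define D where "D = (\<lambda>x. of_real (R\<^sup>2) - cnj a * x)"
  have low: "norm (D x) \<ge> R\<^sup>2 / 2" if "norm x \<le> R / 2" for x
  proof -
    have "norm a * norm x \<le> R * (R / 2)" using a that R by (intro mult_mono) auto
    moreover have "norm (D x) \<ge> R\<^sup>2 - norm a * norm x"
      using norm_triangle_ineq2[of "of_real (R\<^sup>2)" "cnj a * x"] by (simp add: D_def norm_mult norm_power)
    ultimately show ?thesis by (simp add: power2_eq_square)
  qed
  have R2: "R\<^sup>2 > 0" using R by simp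
  have pos: "norm (D x) > 0" if "norm x \<le> R / 2" for x
    using low[OF that] R2 by linarith
  have *: "ln (norm (D x)) - ln (norm (D y)) \<le> 2 * norm (x - y) / R"
    if "norm x \<le> R / 2" "norm y \<le> R / 2" for x y
  proof -
    have "ln (norm (D x)) - ln (norm (D y)) = ln (norm (D x) / norm (D y))"
      using pos that by (subst ln_div) auto
    also have "\<dots> \<le> norm (D x) / norm (D y) - 1" using pos that by (intro ln_le_minus_one divide_pos_pos) auto
    also have "\<dots> = (norm (D x) - norm (D y)) / norm (D y)" using pos[OF that(2)] by (simp add: diff_divide_distrib)
    also have "\<dots> \<le> norm (D x - D y) / norm (D y)" by (intro divide_right_mono norm_triangle_ineq2) auto
    also have "D x - D y = cnj a * (y - x)" by (simp add: D_def algebra_simps)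
    also have "norm \<dots> / norm (D y) \<le> (R * norm (x - y)) / (R\<^sup>2 / 2)"
      unfolding norm_mult using a low[OF that(2)] R2 R
      by (intro frac_le mult_mono) (auto simp: norm_minus_commute)
    also have "\<dots> = 2 * norm (x - y) / R" using R by (simp add: power2_eq_square)
    finally show ?thesis .
  qed
  have B: "ln (norm (blaschke R a x)) = ln R + ln (norm (x - a)) - ln (norm (D x))"
    if "norm x \<le> R / 2" "x \<noteq> a" for x
  proof -
    have "norm (blaschke R a x) = R * norm (x - a) / norm (D x)"
      using R by (simp add: blaschke_def D_def norm_mult norm_divide)
    thus ?thesis using pos[OF that(1)] R that by (simp add: ln_mult ln_div)
  qed
  show ?thesis unfolding B[OF x] B[OF y]
    using *[OF x(1) y(1)] *[OF y(1) x(1)] by (simp add: norm_minus_commute abs_if)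
qed

lemma ln_norm_difference:
  assumes f: "f nicely_meromorphic_on UNIV" and circ: "\<And>w. norm w = R \<Longrightarrow> f w \<noteq> 0" and R: "R > 0"
    and x: "norm x \<le> R / 2" "f x \<noteq> 0" and y: "norm y \<le> R / 2" "f y \<noteq> 0"
  shows "ln (norm (f x)) - ln (norm (f y)) \<le>
     2 * norm (x - y) / R * integral {0..2*pi} (\<lambda>t. \<bar>ln (norm (f (of_real R * cis t)))\<bar>) +
     (\<Sum>a | norm a < R \<and> f a = 0. \<bar>of_int (zorder f a)\<bar> *
        (\<bar>ln (norm (x - a)) - ln (norm (y - a))\<bar> + 2 * norm (x - y) / R))"
proof -
  define S where "S = {a. norm a < R \<and> f a = 0}"
  define u where "u = (\<lambda>t. ln (norm (f (of_real R * cis t))))"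
  define k where "k = (\<lambda>z t. poisson_kernel (of_real R * cis t) z)"
  define Q where "Q = (\<lambda>z. \<Sum>a\<in>S. of_int (zorder f a) * ln (norm (blaschke R a z)))"
  define I where "I = integral {0..2*pi} (\<lambda>t. \<bar>u t\<bar>)"
  have nw: "norm (of_real R * cis t) = R" for t using R by (simp add: norm_mult)
  have ucont: "continuous_on {0..2*pi} u"
    unfolding u_def using nw circ R
    by (intro continuous_intros continuous_on_circle[OF f(1)]) auto
  have int: "(\<lambda>t. \<bar>u t\<bar>) integrable_on {0..2*pi}"
    by (intro integrable_continuous_real continuous_intros ucont)
  have PJ: "((\<lambda>t. k z t * u t) has_integral (2 * pi * (ln (norm (f z)) - Q z))) {0..2*pi}"
    if "norm z \<le> R / 2" "f z \<noteq> 0" for z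
    using poisson_jensen[OF f circ _ that(2)] that(1) R unfolding k_def u_def Q_def S_def by simp
  have "((\<lambda>t. k x t * u t - k y t * u t) has_integral
      (2 * pi * (ln (norm (f x)) - Q x) - 2 * pi * (ln (norm (f y)) - Q y))) {0..2*pi}"
    by (intro has_integral_diff PJ x y)
  moreover have "((\<lambda>t. 8 * norm (x - y) / R * \<bar>u t\<bar>) has_integral (8 * norm (x - y) / R * I)) {0..2*pi}"
    unfolding I_def by (intro has_integral_mult_right integrable_integral int)
  ultimately have "2 * pi * (ln (norm (f x)) - Q x) - 2 * pi * (ln (norm (f y)) - Q y) \<le> 8 * norm (x - y) / R * I"
  proof (rule has_integral_le)
    fix t
    have "k x t * u t - k y t * u t = (k x t - k y t) * u t" by (simp add: algebra_simps)
    also have "\<dots> \<le> \<bar>k x t - k y t\<bar> * \<bar>u t\<bar>" using abs_ge_self[of "(k x t - k y t) * u t"] by (simp add: abs_mult)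
    also have "\<dots> \<le> 8 * norm (x - y) / R * \<bar>u t\<bar>" unfolding k_def
      by (intro mult_right_mono poisson_kernel_diff nw x y R) auto
    finally show "k x t * u t - k y t * u t \<le> 8 * norm (x - y) / R * \<bar>u t\<bar>" .
  qed
  hence "2 * pi * (ln (norm (f x)) - ln (norm (f y)) - (Q x - Q y)) \<le> 8 * norm (x - y) / R * I"
    unfolding right_diff_distrib by linarith
  hence "ln (norm (f x)) - ln (norm (f y)) - (Q x - Q y) \<le> 8 * norm (x - y) / R * I / (2 * pi)"
    by (subst pos_le_divide_eq) (auto simp: mult.commute)
  \<comment> \<open>Replacing 2 pi by the smaller 4 leaves the round constant 2.\<close>
  also have "\<dots> \<le> 8 * norm (x - y) / R * I / 4"
    using pi_gt3 R unfolding I_def by (intro divide_left_mono mult_nonneg_nonneg integral_nonneg int) auto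
  also have "\<dots> = 2 * norm (x - y) / R * I" by simp
  finally have 1: "ln (norm (f x)) - ln (norm (f y)) \<le> 2 * norm (x - y) / R * I + (Q x - Q y)" by linarith
  have "Q x - Q y = (\<Sum>a\<in>S. of_int (zorder f a) * (ln (norm (blaschke R a x)) - ln (norm (blaschke R a y))))"
    by (simp add: Q_def sum_subtractf right_diff_distrib)
  also have "\<dots> \<le> (\<Sum>a\<in>S. \<bar>of_int (zorder f a)\<bar> *
        (\<bar>ln (norm (x - a)) - ln (norm (y - a))\<bar> + 2 * norm (x - y) / R))"
  proof (rule sum_mono)
    fix a assume a: "a \<in> S"
    have "of_int (zorder f a) * (ln (norm (blaschke R a x)) - ln (norm (blaschke R a y)))
       \<le> \<bar>of_int (zorder f a)\<bar> * \<bar>ln (norm (blaschke R a x)) - ln (norm (blaschke R a y))\<bar>"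
      unfolding abs_mult[symmetric] by (rule abs_ge_self)
    also have "\<dots> \<le> \<bar>of_int (zorder f a)\<bar> *
        (\<bar>ln (norm (x - a)) - ln (norm (y - a))\<bar> + 2 * norm (x - y) / R)"
      using a x y by (intro mult_left_mono ln_norm_blaschke_diff) (auto simp: S_def)
    finally show "of_int (zorder f a) * (ln (norm (blaschke R a x)) - ln (norm (blaschke R a y))) \<le> \<dots>" .
  qed
  finally show ?thesis using 1 by (simp add: S_def I_def u_def)
qed

section \<open>Choice of a radius by averaging\<close>

text \<open>The function is sgn(u) |u|^(1-q) / (1-q), written with \<open>max\<close> so that it is
  visibly continuous at 0, where the derivative blows up.\<close>

lemma signed_powr_has_derivative:
  assumes q: "0 < q" "q < 1" and "u \<noteq> 0"
  shows "((\<lambda>u. ((max 0 u) powr (1 - q) - (max 0 (-u)) powr (1 - q)) / (1 - q))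
     has_real_derivative \<bar>u\<bar> powr (-q)) (at u)"
proof (cases "u > 0")
  case True
  have "((\<lambda>u. u powr (1 - q) / (1 - q)) has_real_derivative \<bar>u\<bar> powr (-q)) (at u)"
    using True q by (auto intro!: derivative_eq_intros)
  thus ?thesis
    by (rule has_field_derivative_transform_within_open[of _ _ _ "{0<..}"]) (use True q in auto)
next
  case False
  have "((\<lambda>u. - ((-u) powr (1 - q)) / (1 - q)) has_real_derivative \<bar>u\<bar> powr (-q)) (at u)"
    using False assms by (auto intro!: derivative_eq_intros)
  thus ?thesis
    by (rule has_field_derivative_transform_within_open[of _ _ _ "{..<0}"]) (use False assms in auto)
qed

text \<open>
  The left-hand side is almost everywhere the derivative of the continuous function
  \<open>\<Sum> w\<^sub>i sgn(\<rho> - b\<^sub>i) |\<rho> - b\<^sub>i|\<^sup>1\<^sup>-\<^sup>q / (1 - q)\<close>, so it cannot exceed the stated bound on all of \<open>[P, 2P]\<close>.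
\<close>

lemma exists_good_radius:
  fixes w b :: "'i \<Rightarrow> real"
  assumes fin: "finite I" and w: "\<And>i. i \<in> I \<Longrightarrow> w i \<ge> 0" and b: "\<And>i. i \<in> I \<Longrightarrow> 0 \<le> b i \<and> b i \<le> B"
    and q: "0 < q" "q < 1" and P: "P > 0" and B: "B \<ge> 0"
  obtains \<rho> where "P \<le> \<rho>" "\<rho> \<le> 2 * P" "\<And>i. i \<in> I \<Longrightarrow> \<rho> \<noteq> b i"
    "(\<Sum>i\<in>I. w i * \<bar>\<rho> - b i\<bar> powr (-q)) \<le> (1 + sum w I) * (2 * (2 * P + B) powr (1 - q) / ((1 - q) * P))"
proof -
  define \<phi> where "\<phi> = (\<lambda>u::real. ((max 0 u) powr (1 - q) - (max 0 (-u)) powr (1 - q)) / (1 - q))"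
  \<comment> \<open>Each value of \<open>\<phi>\<close> involved is at most (2P + B)^(1-q) / (1-q)
    in modulus, so an increment over [P, 2P] is at most c * P.\<close>
  define c where "c = 2 * (2 * P + B) powr (1 - q) / ((1 - q) * P)"
  \<comment> \<open>The extra 1 keeps the final comparison strict even if all weights
    vanish.\<close>
  define C where "C = (1 + sum w I) * c"
  define G where "G = (\<lambda>\<rho>. \<Sum>i\<in>I. w i * \<bar>\<rho> - b i\<bar> powr (-q))"
  define F where "F = (\<lambda>\<rho>. \<Sum>i\<in>I. w i * \<phi> (\<rho> - b i))"
  have c0: "c > 0" unfolding c_def using q P B by (intro divide_pos_pos mult_pos_pos) auto
  have "\<exists>\<rho>\<in>{P..2*P}. \<rho> \<notin> b ` I \<and> G \<rho> \<le> C"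
  proof (rule ccontr)
    assume "\<not> (\<exists>\<rho>\<in>{P..2*P}. \<rho> \<notin> b ` I \<and> G \<rho> \<le> C)"
    hence big: "G \<rho> > C" if "\<rho> \<in> {P..2*P}" "\<rho> \<notin> b ` I" for \<rho> using that by force
    \<comment> \<open>At the finitely many singular radii the integrand is set to C, so that C is a
      lower bound on the whole interval.\<close>
    have "((\<lambda>\<rho>. if \<rho> \<in> b ` I then C else G \<rho>) has_integral (F (2 * P) - F P)) {P..2*P}"
    proof (rule fundamental_theorem_of_calculus_interior_strong[where S = "b ` I"])
      show "continuous_on {P..2*P} F" unfolding F_def \<phi>_def
        using q by (intro continuous_intros continuous_on_powr') auto
      fix \<rho> assume \<rho>: "\<rho> \<in> {P<..<2*P} - b ` I"
      have "(F has_real_derivative G \<rho>) (at \<rho>)" unfolding F_def G_def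
      proof (intro DERIV_sum DERIV_cmult)
        fix i assume "i \<in> I"
        hence "\<rho> - b i \<noteq> 0" using \<rho> by auto
        from signed_powr_has_derivative[OF q this]
        show "((\<lambda>\<rho>. \<phi> (\<rho> - b i)) has_real_derivative \<bar>\<rho> - b i\<bar> powr (-q)) (at \<rho>)"
          unfolding \<phi>_def using DERIV_shift[of _ _ \<rho> "- b i"] by simp
      qed
      thus "(F has_vector_derivative (if \<rho> \<in> b ` I then C else G \<rho>)) (at \<rho>)"
        using \<rho> by (simp add: has_real_derivative_iff_has_vector_derivative)
    qed (use fin P in auto)
    note Fint = this
    have "((\<lambda>_. C) has_integral (C * P)) {P..2*P}"
      using has_integral_const_real[of C P "2 * P"] P by (simp add: mult.commute)
    hence "C * P \<le> F (2 * P) - F P"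
      by (rule has_integral_le[OF _ Fint]) (use big in force)
    also have "\<dots> = (\<Sum>i\<in>I. w i * (\<phi> (2 * P - b i) - \<phi> (P - b i)))"
      by (simp add: F_def sum_subtractf right_diff_distrib)
    also have "\<dots> \<le> (\<Sum>i\<in>I. w i * (c * P))"
    proof (intro sum_mono mult_left_mono w)
      fix i assume i: "i \<in> I"
      have *: "(max 0 u) powr (1 - q) \<le> (2 * P + B) powr (1 - q)" if "u \<le> 2 * P + B" for u
        using that P B q by (intro powr_mono2) auto
      have "\<phi> (2 * P - b i) - \<phi> (P - b i) \<le> ((2 * P + B) powr (1 - q) + (2 * P + B) powr (1 - q)) / (1 - q)"
        unfolding \<phi>_def diff_divide_distrib[symmetric]
        using *[of "2 * P - b i"] *[of "-(P - b i)"] b[OF i] q P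
        by (intro divide_right_mono) (smt (verit) powr_ge_zero, simp)
      also have "\<dots> = c * P" using P by (simp add: c_def)
      finally show "\<phi> (2 * P - b i) - \<phi> (P - b i) \<le> c * P" .
    qed
    also have "\<dots> = sum w I * c * P" by (simp add: sum_distrib_right mult.assoc)
    also have "\<dots> < C * P" unfolding C_def using c0 P by (intro mult_strict_right_mono) auto
    finally show False by simp
  qed
  then obtain \<rho> where "\<rho> \<in> {P..2*P}" "\<rho> \<notin> b ` I" "G \<rho> \<le> C" by blast
  thus ?thesis by (intro that[of \<rho>]) (auto simp: G_def C_def c_def)
qed

section \<open>Orders of growth and the iterated shift\<close>

text \<open>Adding ic leaves the real part unchanged, so off the cut the value stays in the
  half-plane of the branch. On the cut it moves up the imaginary axis, and c \<ge> 0 keeps it on the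
  upper half, where the branch takes its values.\<close>

lemma imag_cut_sqrt_shifted:
  assumes s: "imag_cut_sqrt s" and c: "c \<ge> 0"
  shows "s ((s x + \<i> * of_real c)\<^sup>2) = s x + \<i> * of_real c"
proof (cases "x \<in> \<real>\<^sub>\<le>\<^sub>0")
  case True
  then obtain r where r: "x = of_real r" "r \<le> 0" by (auto elim!: nonpos_Reals_cases)
  define t where "t = sqrt (- r)"
  have t: "t \<ge> 0" "x = of_real (- (t\<^sup>2))" using r by (auto simp: t_def)
  have cut: "s (of_real (- (t\<^sup>2))) = \<i> * of_real t" if "t \<ge> 0" for t
    using s that unfolding imag_cut_sqrt_def by blast
  have "s x + \<i> * of_real c = \<i> * of_real (t + c)" using cut[OF t(1)] t by (simp add: algebra_simps)
  moreover have "(\<i> * of_real (t + c))\<^sup>2 = of_real (- ((t + c)\<^sup>2))" by (simp add: power_mult_distrib)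
  ultimately show ?thesis using cut[of "t + c"] t c by simp
next
  case False
  define w where "w = s x + \<i> * of_real c"
  have sq: "(s (w\<^sup>2))\<^sup>2 = w\<^sup>2" using s unfolding imag_cut_sqrt_def by blast
  have Re: "(\<forall>x. x \<notin> \<real>\<^sub>\<le>\<^sub>0 \<longrightarrow> Re (s x) > 0) \<or> (\<forall>x. x \<notin> \<real>\<^sub>\<le>\<^sub>0 \<longrightarrow> Re (s x) < 0)"
    using s unfolding imag_cut_sqrt_def by blast
  have "Re w = Re (s x)" by (simp add: w_def)
  hence Rw: "Re w \<noteq> 0" using Re False by force
  have "w\<^sup>2 \<notin> \<real>\<^sub>\<le>\<^sub>0"
  proof
    assume "w\<^sup>2 \<in> \<real>\<^sub>\<le>\<^sub>0"
    hence "Im (w\<^sup>2) = 0" "Re (w\<^sup>2) \<le> 0" by (auto simp: complex_nonpos_Reals_iff)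
    hence "Im w = 0" "(Re w)\<^sup>2 \<le> (Im w)\<^sup>2" using Rw by (auto simp: power2_eq_square)
    thus False using Rw by simp
  qed
  hence "(Re (s (w\<^sup>2)) > 0 \<and> Re w > 0) \<or> (Re (s (w\<^sup>2)) < 0 \<and> Re w < 0)"
    using Re False \<open>Re w = Re (s x)\<close> by auto
  moreover have "s (w\<^sup>2) = w \<or> s (w\<^sup>2) = - w" using sq by (simp add: power2_eq_iff)
  ultimately have "s (w\<^sup>2) = w" by auto
  thus ?thesis by (simp add: w_def)
qed

lemma wilson_iter_eq:
  assumes "imag_cut_sqrt s"
  shows "wilson_iter s k x = (s x + \<i> * of_nat k / 2)\<^sup>2"
proof (induction k)
  case 0
  show ?case using assms by (simp add: wilson_iter_def imag_cut_sqrt_def)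
next
  case (Suc k)
  have "wilson_iter s (Suc k) x = wilson_shift s (wilson_iter s k x)"
    by (simp add: wilson_iter_def)
  also have "\<dots> = (s ((s x + \<i> * of_real (k / 2))\<^sup>2) + \<i> / 2)\<^sup>2"
    by (simp add: Suc.IH wilson_shift_def)
  also have "s ((s x + \<i> * of_real (k / 2))\<^sup>2) = s x + \<i> * of_real (k / 2)"
    by (rule imag_cut_sqrt_shifted[OF assms]) simp
  also have "(s x + \<i> * of_real (k / 2) + \<i> / 2)\<^sup>2 = (s x + \<i> * of_nat (Suc k) / 2)\<^sup>2"
    by (simp add: field_simps)
  finally show ?case .
qed

section \<open>Order, characteristic and maximum modulus\<close>

lemma ln_le_iff_le_exp: "(x::real) > 0 \<Longrightarrow> ln x \<le> c \<longleftrightarrow> x \<le> exp c"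
  by (metis exp_le_cancel_iff exp_ln)

lemma growth_order_less_imp_char_le:
  assumes "growth_order f < ereal \<tau>" "\<tau> > 0"
  shows "eventually (\<lambda>r. nevanlinna_char f r \<le> r powr \<tau>) at_top"
  using Limsup_lessD[OF assms(1)[unfolded growth_order_def]] eventually_gt_at_top[of 1]
proof eventually_elim
  case (elim r)
  hence less: "log_plus (nevanlinna_char f r) < \<tau> * ln r" by (simp add: field_simps)
  have r1: "1 \<le> r powr \<tau>" using elim assms by (simp add: ge_one_powr_ge_zero)
  show ?case
  proof (cases "nevanlinna_char f r \<le> 1")
    case True
    thus ?thesis using r1 by linarith
  next
    case False
    hence "ln (nevanlinna_char f r) \<le> \<tau> * ln r" using less by (simp add: log_plus_def)
    thus ?thesis using ln_le_iff_le_exp[of "nevanlinna_char f r" "\<tau> * ln r"] False elim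
      by (simp add: powr_def)
  qed
qed

text \<open>Keeps -infinity out of the arithmetic with orders in \<open>theorem6p5\<close>.\<close>

lemma growth_order_nonneg: "growth_order f \<ge> 0"
proof -
  have "(0::ereal) = Limsup at_top (\<lambda>r::real. 0)" by (simp add: Limsup_const)
  also have "\<dots> \<le> growth_order f" unfolding growth_order_def
    by (rule Limsup_mono) (use eventually_gt_at_top[of 1] in eventually_elim, auto simp: log_plus_nonneg)
  finally show ?thesis .
qed

lemma entire_counting_fun:
  assumes "A holomorphic_on UNIV"
  shows "counting_fun A r = 0"
proof -
  have "\<not> is_pole A z" for z
    using assms not_is_pole_holomorphic[of UNIV z A] by simp
  hence "pole_count A t = 0" for t by (simp add: pole_count_def)
  thus ?thesis by (simp add: counting_fun_def)
qed

lemma growth_order_entire_le: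
  assumes A: "A holomorphic_on UNIV" and \<tau>: "\<tau> > 0"
    and le: "eventually (\<lambda>r. \<forall>x. norm x = r \<longrightarrow> norm (A x) \<le> exp (r powr \<tau>)) at_top"
  shows "growth_order A \<le> ereal \<tau>"
  unfolding growth_order_def
proof (rule Limsup_bounded)
  show "eventually (\<lambda>r. ereal (log_plus (nevanlinna_char A r) / ln r) \<le> ereal \<tau>) at_top"
    using le eventually_gt_at_top[of 1]
  proof eventually_elim
    case (elim r)
    have nw: "norm (of_real r * cis t) = r" for t using elim by (simp add: norm_mult)
    have cont: "continuous_on UNIV A" using A by (rule holomorphic_on_imp_continuous_on)
    have "continuous_on {0..2*pi} (\<lambda>t. log_plus (norm (A (of_real r * cis t))))"
      by (intro continuous_on_log_plus_norm continuous_on_compose2[OF cont] continuous_intros) auto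
    hence "integral {0..2*pi} (\<lambda>t. log_plus (norm (A (of_real r * cis t)))) \<le> integral {0..2*pi} (\<lambda>t. r powr \<tau>)"
    proof (intro integral_le integrable_continuous_real continuous_on_const)
      fix t
      have "norm (A (of_real r * cis t)) \<le> exp (r powr \<tau>)" using elim nw by blast
      thus "log_plus (norm (A (of_real r * cis t))) \<le> r powr \<tau>"
        using ln_le_iff_le_exp[of "norm (A (of_real r * cis t))" "r powr \<tau>"]
        unfolding log_plus_def by (smt (verit) powr_ge_zero)
    qed
    also have "\<dots> = 2 * pi * r powr \<tau>" by simp
    finally have "nevanlinna_char A r \<le> r powr \<tau>"
      unfolding nevanlinna_char_def proximity_fun_def entire_counting_fun[OF A] by (simp add: field_simps)
    hence "log_plus (nevanlinna_char A r) \<le> log_plus (r powr \<tau>)"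
      unfolding log_plus_def using ln_mono[of "nevanlinna_char A r" "r powr \<tau>"] ln_ge_zero[of "r powr \<tau>"]
      by (simp del: ln_powr)
    also have "\<dots> = \<tau> * ln r" using elim \<tau>
      by (simp add: log_plus_eq_max ln_powr)
    finally show ?case using elim by (simp add: field_simps)
  qed
qed

text \<open>For an entire function the zeros only help: their orders are nonnegative and ln
  |blaschke| \<le> 0. A circle of radius R \<ge> 2r puts x in the half disc, where the kernel is at
  most 3.\<close>

lemma entire_modulus_bound:
  assumes A: "A holomorphic_on UNIV" and \<tau>: "0 < \<tau>" "\<tau> < \<tau>'"
    and T: "eventually (\<lambda>r. nevanlinna_char A r \<le> r powr \<tau>) at_top"
  shows "eventually (\<lambda>r. \<forall>x. norm x \<le> r \<longrightarrow> norm (A x) \<le> exp (r powr \<tau>')) at_top"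
proof (cases "\<exists>x0. A x0 \<noteq> 0")
  case False
  thus ?thesis by simp
next
  case True
  then obtain x0 where x0: "A x0 \<noteq> 0" by blast
  have nm: "A nicely_meromorphic_on UNIV"
    using A by (simp add: analytic_on_imp_nicely_meromorphic_on analytic_on_open)
  obtain R0 where R0: "\<And>R. R \<ge> R0 \<Longrightarrow> nevanlinna_char A R \<le> R powr \<tau>"
    using T unfolding eventually_at_top_linorder by blast
  have "eventually (\<lambda>r::real. 3 * (3 * r) powr \<tau> \<le> r powr \<tau>') at_top" using \<tau> by real_asymp
  moreover have "eventually (\<lambda>r. r \<ge> max 1 R0) at_top" by (rule eventually_ge_at_top)
  ultimately show ?thesis
  proof eventually_elim
    case (elim r)
    obtain R where R: "2 * r \<le> R" "R \<le> 3 * r" and circ: "\<And>w. norm w = R \<Longrightarrow> A w \<noteq> 0"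
      using exists_zero_free_circle[OF nm x0, of "2 * r" "3 * r"] elim by auto
    have nw: "norm (of_real R * cis t) = R" for t using R elim by (simp add: norm_mult)
    have "nevanlinna_char A R \<le> R powr \<tau>" using R0[of R] R elim by auto
    also have "\<dots> \<le> (3 * r) powr \<tau>" using R elim \<tau> by (intro powr_mono2) auto
    finally have prox: "3 * proximity_fun A R \<le> r powr \<tau>'"
      using elim by (simp add: nevanlinna_char_def entire_counting_fun[OF A])
    show ?case
    proof (intro allI impI)
      fix x :: complex assume x: "norm x \<le> r"
      show "norm (A x) \<le> exp (r powr \<tau>')"
      proof (cases "A x = 0")
        case False
        define Q where "Q = (\<Sum>a | norm a < R \<and> A a = 0. of_int (zorder A a) * ln (norm (blaschke R a x)))"
        have xR: "norm x < R" "norm x \<le> R / 2" using x R elim by auto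
        have Q0: "Q \<le> 0" unfolding Q_def
        proof (intro sum_nonpos mult_nonneg_nonpos)
          fix a assume a: "a \<in> {a. norm a < R \<and> A a = 0}"
          show "0 \<le> (of_int (zorder A a) :: real)"
            using zorder_neg_iff_is_pole[OF nm x0, of a] not_is_pole_holomorphic[of UNIV a A] A by auto
          have "norm (blaschke R a x) \<le> 1" using a xR by (intro norm_blaschke_le_1) auto
          thus "ln (norm (blaschke R a x)) \<le> 0" by (cases "blaschke R a x = 0") auto
        qed
        have PJ: "((\<lambda>t. poisson_kernel (of_real R * cis t) x * ln (norm (A (of_real R * cis t)))) has_integral
            (2 * pi * (ln (norm (A x)) - Q))) {0..2*pi}"
          unfolding Q_def by (rule poisson_jensen[OF nm circ xR(1) False])
        have "continuous_on {0..2*pi} (\<lambda>t. log_plus (norm (A (of_real R * cis t))))"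
          using R elim by (intro continuous_on_log_plus_norm continuous_on_circle[OF nm circ]) auto
        hence "((\<lambda>t. 3 * log_plus (norm (A (of_real R * cis t)))) has_integral
            3 * integral {0..2*pi} (\<lambda>t. log_plus (norm (A (of_real R * cis t))))) {0..2*pi}"
          by (intro has_integral_mult_right integrable_integral integrable_continuous_real)
        hence "2 * pi * (ln (norm (A x)) - Q) \<le> 3 * integral {0..2*pi} (\<lambda>t. log_plus (norm (A (of_real R * cis t))))"
        proof (rule has_integral_le[OF PJ])
          fix t
          let ?w = "of_real R * cis t" and ?u = "ln (norm (A (of_real R * cis t)))"
          have k: "poisson_kernel ?w x \<le> 3" "poisson_kernel ?w x \<ge> 0"
            using poisson_kernel_bounds[OF nw xR(2), of t] R elim by auto
          have "poisson_kernel ?w x * ?u \<le> poisson_kernel ?w x * max 0 ?u"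
            using k by (intro mult_left_mono) auto
          also have "\<dots> \<le> 3 * max 0 ?u" using k by (intro mult_right_mono) auto
          finally show "poisson_kernel ?w x * ?u \<le> 3 * log_plus (norm (A ?w))"
            using circ[OF nw, of t] by (simp add: log_plus_eq_max)
        qed
        hence "ln (norm (A x)) - Q \<le> 3 * proximity_fun A R"
          unfolding proximity_fun_def by (simp add: field_simps)
        hence "ln (norm (A x)) \<le> r powr \<tau>'" using Q0 prox by linarith
        thus ?thesis using False by (simp add: ln_le_iff_le_exp)
      qed simp
    qed
  qed
qed

section \<open>Ratios of shifted values\<close>

text \<open>
  The points \<open>z\<close> with \<open>(z + ij/2)\<^sup>2 = a\<close> are \<open>\<plusminus>\<surd>a - ij/2\<close>; as \<open>j\<close> runs through \<open>{-n..n}\<close> their moduli are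
  exactly the numbers \<open>|\<surd>a + ij/2|\<close>, so a single sign suffices.
\<close>

definition zero_offset :: "complex \<Rightarrow> int \<Rightarrow> real" where
  "zero_offset a j = norm (csqrt a + \<i> * of_int j / 2)"

text \<open>Up to a constant, a majorant of the logarithmic terms of the zero or pole a, valid at
  all points of |z| = \<rho> and for all shifts at once.\<close>

definition offset_weight :: "nat \<Rightarrow> real \<Rightarrow> real \<Rightarrow> complex \<Rightarrow> real" where
  "offset_weight n q \<rho> a = (\<Sum>j\<in>{- int n..int n}. \<bar>\<rho> - zero_offset a j\<bar> powr (-q))"

text \<open>By the reverse triangle inequality the distance from z to its singular point is at least
  the difference of their moduli, one of the terms of \<open>offset_weight\<close>.\<close>

lemma ln_1_plus_offset_le:
  assumes q: "0 < q" "q < 1" and m: "m \<le> n" and v: "v = csqrt a \<or> v = - csqrt a"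
    and avoid: "\<And>j. j \<in> {- int n..int n} \<Longrightarrow> norm z \<noteq> zero_offset a j"
  shows "z + \<i> * of_nat m / 2 + v \<noteq> 0"
    "ln (1 + n / norm (z + \<i> * of_nat m / 2 + v)) \<le> 2 / q * real n * offset_weight n q (norm z) a"
proof -
  obtain j where j: "j \<in> {- int n..int n}" and jv: "zero_offset a j = norm (v + \<i> * of_nat m / 2)"
  proof (cases "v = csqrt a")
    case True
    thus ?thesis using m by (intro that[of "int m"]) (auto simp: zero_offset_def)
  next
    case False
    \<comment> \<open>For the root of opposite sign, negating the vector turns the shift m into
      -m.\<close>
    hence "v + \<i> * of_nat m / 2 = - (csqrt a + \<i> * of_int (- int m) / 2)" using v by simp
    hence "norm (v + \<i> * of_nat m / 2) = zero_offset a (- int m)"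
      unfolding zero_offset_def by (metis norm_minus_cancel)
    thus ?thesis using m by (intro that[of "- int m"]) auto
  qed
  define u where "u = z + \<i> * of_nat m / 2 + v"
  have "\<bar>norm z - norm (v + \<i> * of_nat m / 2)\<bar> \<le> norm (z + (v + \<i> * of_nat m / 2))"
    using norm_triangle_ineq3[of z "- (v + \<i> * of_nat m / 2)"]
    by (simp only: norm_minus_cancel diff_minus_eq_add)
  also have "z + (v + \<i> * of_nat m / 2) = u" by (simp add: u_def)
  finally have le: "\<bar>norm z - zero_offset a j\<bar> \<le> norm u" by (simp add: jv)
  have pos: "\<bar>norm z - zero_offset a j\<bar> > 0" using avoid[OF j] by simp
  hence u0: "norm u > 0" using le by linarith
  thus "z + \<i> * of_nat m / 2 + v \<noteq> 0" by (simp add: u_def)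
  have "ln (1 + n / norm u) \<le> 2 / q * (n / norm u) powr q"
    using q by (intro ln_1_plus_le_powr) auto
  also have "(n / norm u) powr q = real n powr q * norm u powr (-q)"
    by (simp add: powr_divide powr_minus divide_simps)
  also have "2 / q * \<dots> \<le> 2 / q * (n * offset_weight n q (norm z) a)"
  proof (intro mult_left_mono mult_mono)
    show "real n powr q \<le> real n"
      using q powr_mono[of q 1 "real n"] by (cases "n = 0") auto
    have "norm u powr (-q) \<le> \<bar>norm z - zero_offset a j\<bar> powr (-q)"
      using le pos q by (intro powr_mono2') auto
    also have "\<dots> \<le> offset_weight n q (norm z) a"
      unfolding offset_weight_def by (rule member_le_sum[OF j]) auto
    finally show "norm u powr (-q) \<le> offset_weight n q (norm z) a" .
  qed (use q in auto)
  finally show "ln (1 + n / norm (z + \<i> * of_nat m / 2 + v)) \<le> 2 / q * real n * offset_weight n q (norm z) a"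
    by (simp only: u_def mult.assoc)
qed

lemma abs_half_diff_le:
  assumes "k \<le> n" "l \<le> n"
  shows "\<bar>(real k - real l) / 2\<bar> \<le> real n / 2"
proof -
  have "\<bar>real k - real l\<bar> \<le> real n" using assms by (auto simp: abs_if)
  thus ?thesis by simp
qed

text \<open>The difference (z + im/2)^2 - a splits into two linear factors in z, and each moves by
  at most n between the shifts. The 8 is two factors, times two terms of
  \<open>abs_diff_ln_norm_le\<close>, times the 2 of \<open>ln_1_plus_le_powr\<close>.\<close>

lemma shifted_squares_ln_diff:
  fixes z :: complex and n k l :: nat
  assumes q: "0 < q" "q < 1" and k: "k \<le> n" and l: "l \<le> n"
    and avoid: "\<And>j. j \<in> {- int n..int n} \<Longrightarrow> norm z \<noteq> zero_offset a j"
  shows "(z + \<i> * of_nat k / 2)\<^sup>2 \<noteq> a"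
    "\<bar>ln (norm ((z + \<i> * of_nat k / 2)\<^sup>2 - a)) - ln (norm ((z + \<i> * of_nat l / 2)\<^sup>2 - a))\<bar>
       \<le> 8 * real n / q * offset_weight n q (norm z) a"
proof -
  define u where "u m v = z + \<i> * of_nat m / 2 + v" for m :: nat and v
  note off = ln_1_plus_offset_le[OF q _ _ avoid, folded u_def]
  have nz: "u m (csqrt a) \<noteq> 0" "u m (- csqrt a) \<noteq> 0" if "m \<le> n" for m
    using off(1)[OF that] by auto
  have fac: "(z + \<i> * of_nat m / 2)\<^sup>2 - a = u m (csqrt a) * u m (- csqrt a)" for m
  proof -
    have "a = (csqrt a)\<^sup>2" by (simp only: power2_csqrt)
    thus ?thesis by (simp add: u_def algebra_simps power2_eq_square del: csqrt.simps)
  qed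
  show "(z + \<i> * of_nat k / 2)\<^sup>2 \<noteq> a" using fac[of k] nz[OF k] by auto
  have d: "norm (u k v - u l v) \<le> real n" for v
  proof -
    have "u k v - u l v = \<i> * of_real ((real k - real l) / 2)" by (simp add: u_def field_simps)
    hence "norm (u k v - u l v) = \<bar>(real k - real l) / 2\<bar>" by (simp add: norm_mult del: of_real_divide)
    also have "\<dots> \<le> real n" using abs_half_diff_le[OF k l] by linarith
    finally show ?thesis .
  qed
  have *: "\<bar>ln (norm (u k v)) - ln (norm (u l v))\<bar> \<le> 4 * real n / q * offset_weight n q (norm z) a"
    if v: "v = csqrt a \<or> v = - csqrt a" for v
  proof -
    have "\<bar>ln (norm (u k v)) - ln (norm (u l v))\<bar> \<le> ln (1 + n / norm (u k v)) + ln (1 + n / norm (u l v))"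
      by (rule abs_diff_ln_norm_le[OF off(1)[OF k v] off(1)[OF l v] d])
    also have "\<dots> \<le> 2 / q * real n * offset_weight n q (norm z) a + 2 / q * real n * offset_weight n q (norm z) a"
      by (rule add_mono[OF off(2)[OF k v] off(2)[OF l v]])
    finally show ?thesis by simp
  qed
  have sum_ln: "ln (norm ((z + \<i> * of_nat m / 2)\<^sup>2 - a)) = ln (norm (u m (csqrt a))) + ln (norm (u m (- csqrt a)))"
    if "m \<le> n" for m
    using nz[OF that] by (simp add: fac norm_mult ln_mult)
  show "\<bar>ln (norm ((z + \<i> * of_nat k / 2)\<^sup>2 - a)) - ln (norm ((z + \<i> * of_nat l / 2)\<^sup>2 - a))\<bar>
       \<le> 8 * real n / q * offset_weight n q (norm z) a"
  proof -
    have "8 * real n / q * offset_weight n q (norm z) a =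
      4 * real n / q * offset_weight n q (norm z) a + 4 * real n / q * offset_weight n q (norm z) a" by simp
    thus ?thesis using *[OF disjI1[OF refl]] *[OF disjI2[OF refl]] sum_ln[OF k] sum_ln[OF l] by linarith
  qed
qed

text \<open>The bound (|z| + n)^2 \<le> R/2 places all shifted squares in the half disc of
  \<open>ln_norm_difference\<close>; factoring a difference of squares bounds their distances by n
  (|z| + n).\<close>

lemma shifted_value_ratio:
  fixes z :: complex and n k l :: nat
  assumes f: "f nicely_meromorphic_on UNIV" and circ: "\<And>w. norm w = R \<Longrightarrow> f w \<noteq> 0"
    and R: "0 < R" "(norm z + n)\<^sup>2 \<le> R / 2" and q: "0 < q" "q < 1" and k: "k \<le> n" and l: "l \<le> n"
    and avoid: "\<And>a j. norm a < R \<Longrightarrow> f a = 0 \<Longrightarrow> j \<in> {- int n..int n} \<Longrightarrow> norm z \<noteq> zero_offset a j"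
  shows "f ((z + \<i> * of_nat k / 2)\<^sup>2) \<noteq> 0"
    "ln (norm (f ((z + \<i> * of_nat k / 2)\<^sup>2))) - ln (norm (f ((z + \<i> * of_nat l / 2)\<^sup>2))) \<le>
       2 * (n * (norm z + n)) / R *
         (integral {0..2*pi} (\<lambda>t. \<bar>ln (norm (f (of_real R * cis t)))\<bar>) + zero_pole_count f R) +
       8 * real n / q * (\<Sum>a | norm a < R \<and> f a = 0. \<bar>of_int (zorder f a)\<bar> * offset_weight n q (norm z) a)"
proof -
  define S where "S = {a. norm a < R \<and> f a = 0}"
  define x where "x = (\<lambda>m::nat. (z + \<i> * of_nat m / 2)\<^sup>2)"
  define I where "I = integral {0..2*pi} (\<lambda>t. \<bar>ln (norm (f (of_real R * cis t)))\<bar>)"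
  have I0: "I \<ge> 0" unfolding I_def by (rule integral_nonneg_total) auto
  have xn: "norm (x m) \<le> R / 2" if "m \<le> n" for m
  proof -
    have "norm (z + \<i> * of_nat m / 2) \<le> norm z + norm (\<i> * of_nat m / 2)" by (rule norm_triangle_ineq)
    also have "norm (\<i> * of_nat m / 2) \<le> n" using that by (simp add: norm_mult norm_divide)
    finally have "(norm (z + \<i> * of_nat m / 2))\<^sup>2 \<le> (norm z + n)\<^sup>2" by (intro power_mono) auto
    thus ?thesis using R unfolding x_def norm_power by linarith
  qed
  have fx: "f (x m) \<noteq> 0" if "m \<le> n" for m
  proof
    assume "f (x m) = 0"
    moreover have "norm (x m) < R" using xn[OF that] R by linarith
    ultimately show False
      using shifted_squares_ln_diff(1)[OF q that that avoid[of "x m"]] by (simp add: x_def)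
  qed
  show "f ((z + \<i> * of_nat k / 2)\<^sup>2) \<noteq> 0" using fx[OF k] by (simp add: x_def)
  have dist: "norm (x k - x l) \<le> n * (norm z + n)"
  proof -
    have "x k - x l = (\<i> * of_real ((real k - real l) / 2)) * (2 * z + \<i> * of_nat (k + l) / 2)"
      by (simp add: x_def field_simps power2_eq_square)
    hence "norm (x k - x l) = \<bar>(real k - real l) / 2\<bar> * norm (2 * z + \<i> * of_nat (k + l) / 2)"
      by (simp add: norm_mult del: of_real_divide)
    also have "\<dots> \<le> (n / 2) * (2 * (norm z + n))"
    proof (intro mult_mono)
      have "norm (2 * z + \<i> * of_nat (k + l) / 2) \<le> norm (2 * z) + norm (\<i> * of_nat (k + l) / 2)"
        by (rule norm_triangle_ineq)
      also have "norm (\<i> * of_nat (k + l) / 2 :: complex) = (k + l) / 2"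
        by (simp add: norm_mult norm_divide del: of_nat_add)
      also have "norm (2 * z) + (k + l) / 2 \<le> 2 * (norm z + n)"
        using k l by (simp add: norm_mult)
      finally show "norm (2 * z + \<i> * of_nat (k + l) / 2) \<le> 2 * (norm z + n)" .
      show "\<bar>(real k - real l) / 2\<bar> \<le> real n / 2" by (rule abs_half_diff_le[OF k l])
    qed auto
    also have "\<dots> = n * (norm z + n)" by simp
    finally show ?thesis .
  qed
  define c where "c = 2 * (n * (norm z + n)) / R"
  have c: "2 * norm (x k - x l) / R \<le> c" unfolding c_def using dist R by (intro divide_right_mono) auto
  have "ln (norm (f (x k))) - ln (norm (f (x l))) \<le>
     2 * norm (x k - x l) / R * I +
     (\<Sum>a\<in>S. \<bar>of_int (zorder f a)\<bar> *
        (\<bar>ln (norm (x k - a)) - ln (norm (x l - a))\<bar> + 2 * norm (x k - x l) / R))"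
    unfolding I_def S_def by (rule ln_norm_difference[OF f circ R(1) xn[OF k] fx[OF k] xn[OF l] fx[OF l]])
  also have "\<dots> \<le> c * I + (\<Sum>a\<in>S. \<bar>of_int (zorder f a)\<bar> * (8 * real n / q * offset_weight n q (norm z) a + c))"
    using shifted_squares_ln_diff(2)[OF q k l avoid] c I0
    by (intro add_mono sum_mono mult_left_mono mult_right_mono) (auto simp: S_def x_def)
  also have "\<dots> = c * (I + zero_pole_count f R) +
      8 * real n / q * (\<Sum>a\<in>S. \<bar>of_int (zorder f a)\<bar> * offset_weight n q (norm z) a)"
    unfolding zero_pole_count_def S_def[symmetric]
    by (simp add: algebra_simps sum.distrib sum_distrib_left sum_distrib_right)
  finally show "ln (norm (f ((z + \<i> * of_nat k / 2)\<^sup>2))) - ln (norm (f ((z + \<i> * of_nat l / 2)\<^sup>2))) \<le>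
       2 * (n * (norm z + n)) / R *
         (integral {0..2*pi} (\<lambda>t. \<bar>ln (norm (f (of_real R * cis t)))\<bar>) + zero_pole_count f R) +
       8 * real n / q * (\<Sum>a | norm a < R \<and> f a = 0. \<bar>of_int (zorder f a)\<bar> * offset_weight n q (norm z) a)"
    by (simp add: x_def S_def c_def I_def)
qed

lemma zero_offset_le:
  assumes "j \<in> {- int n..int n}"
  shows "zero_offset a j \<le> sqrt (norm a) + n"
proof -
  have "zero_offset a j \<le> norm (csqrt a) + norm (\<i> * of_int j / 2)"
    unfolding zero_offset_def by (rule norm_triangle_ineq)
  also have "norm (csqrt a) = sqrt (norm a)"
    by (metis norm_ge_zero norm_power power2_csqrt real_sqrt_unique)
  also have "norm (\<i> * of_int j / 2 :: complex) = of_int \<bar>j\<bar> / 2" by (simp add: norm_mult norm_divide)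
  also have "of_int \<bar>j\<bar> \<le> real_of_int (int n)" using assms unfolding of_int_le_iff by auto
  hence "of_int \<bar>j\<bar> / 2 \<le> real n" by simp
  finally show ?thesis by simp
qed

lemma shifted_value_ratio_growth:
  fixes n :: nat
  assumes f: "f nicely_meromorphic_on UNIV" "f x \<noteq> 0" and \<beta>: "0 < \<beta>" "\<beta> < \<gamma>" and n: "n \<ge> 1"
    and T: "eventually (\<lambda>r. nevanlinna_char f r \<le> r powr (\<beta> + 1/2)) at_top"
  shows "eventually (\<lambda>P. \<exists>\<rho>\<ge>P. \<rho> \<le> 2 * P \<and> (\<forall>z. norm z = \<rho> \<longrightarrow> (\<forall>k\<le>n. \<forall>l\<le>n.
     f ((z + \<i> * of_nat k / 2)\<^sup>2) \<noteq> 0 \<and>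
     ln (norm (f ((z + \<i> * of_nat k / 2)\<^sup>2))) - ln (norm (f ((z + \<i> * of_nat l / 2)\<^sup>2))) \<le> (P\<^sup>2) powr \<gamma>))) at_top"
proof -
  \<comment> \<open>The power used is q = 1 - \<delta>. The minimum with 1/2 keeps q in (0, 1); the
    other entry leaves \<gamma> - \<delta> > \<beta>, so that \<tau> exceeds \<beta> + 1/2.\<close>
  define \<delta> where "\<delta> = min (1/2) ((\<gamma> - \<beta>) / 2)"
  have \<delta>: "0 < \<delta>" "\<delta> < 1" "\<delta> < \<gamma>" "\<beta> < \<gamma> - \<delta>" using \<beta> by (auto simp: \<delta>_def min_def field_simps)
  define \<tau> where "\<tau> = \<gamma> - \<delta> + 1/2"
  have \<tau>: "0 < \<beta> + 1/2" "\<beta> + 1/2 < \<tau>" using \<beta> \<delta> by (auto simp: \<tau>_def)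
  define N where "N = real n"
  have N: "N \<ge> 1" using n by (simp add: N_def)
  \<comment> \<open>R will lie between 4 (2P + N)^2 and M P, so R is of size P^2 and (|z| + n)^2
    \<le> R/2 whenever |z| \<le> 2P.\<close>
  define M where "M = (\<lambda>P. 8 * (2 * P + N)\<^sup>2)"
  obtain R1 where R1: "\<And>R. R \<ge> R1 \<Longrightarrow> (\<And>w. norm w = R \<Longrightarrow> f w \<noteq> 0) \<Longrightarrow>
       integral {0..2*pi} (\<lambda>t. \<bar>ln (norm (f (of_real R * cis t)))\<bar>) \<le> R powr \<tau>"
    using growth_of_log_modulus_and_zeros[OF f \<tau> T] unfolding eventually_at_top_linorder by blast
  obtain R2 where R2: "\<And>R. R \<ge> R2 \<Longrightarrow> zero_pole_count f R \<le> R powr \<tau>"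
    using growth_of_zeros[OF f \<tau> T] unfolding eventually_at_top_linorder by blast
  \<comment> \<open>With M P of size P^2, the Poisson term grows like P^(2\<gamma> - 2\<delta>) and
    the averaged term like P^(2\<gamma> - \<delta>), both below P^(2\<gamma>).\<close>
  have "eventually (\<lambda>P. N / (2 * P + N) * M P powr \<tau>
     + 8 * N / (1 - \<delta>) * ((1 + (2 * N + 1) * M P powr \<tau>) *
        (2 * (2 * P + (3 * (2 * P + N) + N)) powr \<delta> / (\<delta> * P))) \<le> (P\<^sup>2) powr \<gamma>) at_top"
    unfolding M_def \<tau>_def using N \<delta> by real_asymp
  moreover have "eventually (\<lambda>P. 4 * (2 * P + N)\<^sup>2 \<ge> max R1 R2) at_top" using N by real_asymp
  ultimately show ?thesis using eventually_ge_at_top[of 1]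
  proof eventually_elim
    case (elim P)
    have PN: "2 * P + N > 0" using elim N by linarith
    hence PN2: "(2 * P + N)\<^sup>2 > 0" by simp
    obtain R where R: "4 * (2 * P + N)\<^sup>2 \<le> R" "R \<le> M P" and circ: "\<And>w. norm w = R \<Longrightarrow> f w \<noteq> 0"
      using exists_zero_free_circle[OF f, of "4 * (2 * P + N)\<^sup>2" "M P"] PN2 unfolding M_def by auto
    have R0: "R > 0" using R PN2 by linarith
    define S where "S = {a. norm a < R \<and> f a = 0}"
    have fin: "finite S" unfolding S_def
      by (rule finite_subset[OF _ finite_zeros_poles[OF f, of R]]) auto
    define J where "J = {- int n..int n}"
    define I where "I = integral {0..2*pi} (\<lambda>t. \<bar>ln (norm (f (of_real R * cis t)))\<bar>)"
    \<comment> \<open>Since 8 \<le> 9, moduli below R have square roots at most 3 (2P + N); a shift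
      adds at most N.\<close>
    define B where "B = 3 * (2 * P + N) + N"
    \<comment> \<open>The weight ignores j: every zero or pole is listed once for each of the 2n + 1
      offsets.\<close>
    define w where "w = (\<lambda>(a, j::int). \<bar>of_int (zorder f a)\<bar> :: real)"
    have RM: "R powr \<tau> \<le> M P powr \<tau>" using R R0 \<tau> \<beta> by (intro powr_mono2) auto
    have "I \<le> R powr \<tau>" unfolding I_def using elim R by (intro R1 circ) auto
    hence IM: "I \<le> M P powr \<tau>" using RM by linarith
    have "zero_pole_count f R \<le> R powr \<tau>" using elim R by (intro R2) auto
    hence ZM: "zero_pole_count f R \<le> M P powr \<tau>" using RM by linarith
    have sumw: "sum w (S \<times> J) = (2 * N + 1) * zero_pole_count f R"
      by (simp add: w_def sum.cartesian_product[symmetric] J_def N_def zero_pole_count_def S_def sum_distrib_left algebra_simps)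
    have offB: "0 \<le> zero_offset a j \<and> zero_offset a j \<le> B" if "a \<in> S" "j \<in> J" for a j
    proof
      show "0 \<le> zero_offset a j" by (simp add: zero_offset_def)
      have "norm a \<le> (3 * (2 * P + N))\<^sup>2"
        using that(1) R PN2 unfolding S_def M_def power_mult_distrib by auto
      hence "sqrt (norm a) \<le> 3 * (2 * P + N)" using PN by (intro real_le_lsqrt) auto
      thus "zero_offset a j \<le> B" using zero_offset_le[of j n a] that(2) by (simp add: B_def J_def N_def)
    qed
    obtain \<rho> where \<rho>: "P \<le> \<rho>" "\<rho> \<le> 2 * P" and avoid: "\<And>i. i \<in> S \<times> J \<Longrightarrow> \<rho> \<noteq> (case i of (a, j) \<Rightarrow> zero_offset a j)"
      and sum_le: "(\<Sum>i\<in>S \<times> J. w i * \<bar>\<rho> - (case i of (a, j) \<Rightarrow> zero_offset a j)\<bar> powr (-(1 - \<delta>)))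
         \<le> (1 + sum w (S \<times> J)) * (2 * (2 * P + B) powr (1 - (1 - \<delta>)) / ((1 - (1 - \<delta>)) * P))"
    proof (rule exists_good_radius[of "S \<times> J" w "\<lambda>(a, j). zero_offset a j" B "1 - \<delta>" P])
      show "finite (S \<times> J)" using fin by (simp add: J_def)
      show "0 \<le> w i" for i by (simp add: w_def case_prod_beta)
      show "0 \<le> (case i of (a, j) \<Rightarrow> zero_offset a j) \<and> (case i of (a, j) \<Rightarrow> zero_offset a j) \<le> B"
        if "i \<in> S \<times> J" for i using that offB by auto
      show "0 < 1 - \<delta>" "1 - \<delta> < 1" "0 < P" "0 \<le> B" using \<delta> elim PN N by (auto simp: B_def)
    qed (rule that)
    have av: "\<rho> \<noteq> zero_offset a j" if "norm a < R" "f a = 0" "j \<in> {- int n..int n}" for a j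
      using avoid[of "(a, j)"] that by (simp add: S_def J_def)
    have sum_eq: "(\<Sum>i\<in>S \<times> J. w i * \<bar>\<rho> - (case i of (a, j) \<Rightarrow> zero_offset a j)\<bar> powr (-(1 - \<delta>)))
       = (\<Sum>a\<in>S. \<bar>of_int (zorder f a)\<bar> * offset_weight n (1 - \<delta>) \<rho> a)"
      by (simp add: w_def sum.cartesian_product offset_weight_def J_def sum_distrib_left case_prod_beta)
    have "(\<Sum>a\<in>S. \<bar>of_int (zorder f a)\<bar> * offset_weight n (1 - \<delta>) \<rho> a) \<le>
        (1 + (2 * N + 1) * zero_pole_count f R) * (2 * (2 * P + B) powr \<delta> / (\<delta> * P))"
      using sum_le unfolding sum_eq sumw by simp
    also have "\<dots> \<le> (1 + (2 * N + 1) * M P powr \<tau>) * (2 * (2 * P + B) powr \<delta> / (\<delta> * P))"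
      using ZM N \<delta> elim by (intro mult_right_mono add_left_mono mult_left_mono) auto
    finally have sum_M: "(\<Sum>a\<in>S. \<bar>of_int (zorder f a)\<bar> * offset_weight n (1 - \<delta>) \<rho> a) \<le> \<dots>" .
    show ?case
    proof (intro exI[of _ \<rho>] conjI allI impI \<rho>)
      fix z :: complex and k l :: nat
      assume z: "norm z = \<rho>" and kl: "k \<le> n" "l \<le> n"
      have "(norm z + real n)\<^sup>2 \<le> (2 * P + N)\<^sup>2" using z \<rho> elim by (intro power_mono) (auto simp: N_def)
      hence zR: "(norm z + real n)\<^sup>2 \<le> R / 2" using R PN2 by linarith
      have q: "0 < 1 - \<delta>" "1 - \<delta> < 1" using \<delta> by auto
      show "f ((z + \<i> * of_nat k / 2)\<^sup>2) \<noteq> 0"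
        by (rule shifted_value_ratio(1)[OF f(1) circ R0 zR q kl]) (use av z in auto)
      have "ln (norm (f ((z + \<i> * of_nat k / 2)\<^sup>2))) - ln (norm (f ((z + \<i> * of_nat l / 2)\<^sup>2))) \<le>
         2 * (N * (\<rho> + N)) / R * (I + zero_pole_count f R) +
         8 * N / (1 - \<delta>) * (\<Sum>a\<in>S. \<bar>of_int (zorder f a)\<bar> * offset_weight n (1 - \<delta>) \<rho> a)"
        unfolding z[symmetric] N_def I_def S_def
        by (rule shifted_value_ratio(2)[OF f(1) circ R0 zR q kl]) (use av z in auto)
      also have "2 * (N * (\<rho> + N)) / R * (I + zero_pole_count f R) \<le>
          N / (2 * (2 * P + N)) * (M P powr \<tau> + M P powr \<tau>)"
      proof (rule mult_mono)
        have "2 * (N * (\<rho> + N)) / R \<le> 2 * (N * (2 * P + N)) / (4 * (2 * P + N)\<^sup>2)"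
          using \<rho> N R PN PN2 by (intro frac_le mult_left_mono) auto
        also have "\<dots> = N / (2 * (2 * P + N))" using PN by (simp add: power2_eq_square divide_simps)
        finally show "2 * (N * (\<rho> + N)) / R \<le> N / (2 * (2 * P + N))" .
        show "I + zero_pole_count f R \<le> M P powr \<tau> + M P powr \<tau>" using IM ZM by (rule add_mono)
        show "0 \<le> I + zero_pole_count f R" unfolding I_def zero_pole_count_def
          by (intro add_nonneg_nonneg integral_nonneg_total sum_nonneg) auto
      qed (use N PN in auto)
      also have "N / (2 * (2 * P + N)) * (M P powr \<tau> + M P powr \<tau>) = N / (2 * P + N) * M P powr \<tau>"
        using PN by (simp add: field_simps)
      also have "8 * N / (1 - \<delta>) * (\<Sum>a\<in>S. \<bar>of_int (zorder f a)\<bar> * offset_weight n (1 - \<delta>) \<rho> a) \<le>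
          8 * N / (1 - \<delta>) * ((1 + (2 * N + 1) * M P powr \<tau>) * (2 * (2 * P + B) powr \<delta> / (\<delta> * P)))"
        using sum_M N \<delta> by (intro mult_left_mono) auto
      also note elim(1)[folded B_def]
      finally show "ln (norm (f ((z + \<i> * of_nat k / 2)\<^sup>2))) - ln (norm (f ((z + \<i> * of_nat l / 2)\<^sup>2))) \<le> (P\<^sup>2) powr \<gamma>"
        by simp
    qed
  qed
qed

section \<open>The Wilson equation\<close>

text \<open>The equation is solved for the coefficient with index l, after division by the nonzero
  value of f at the l-th shift. The n remaining terms cost a factor n \<le> e^n, kept inside the
  exponential.\<close>

lemma wilson_coefficient_bound:
  assumes s: "imag_cut_sqrt s" and n: "n \<ge> 1" and l: "l \<le> n" and f: "f nicely_meromorphic_on UNIV"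
    and eq: "solves_wilson_eq s n A f"
    and ratio: "\<And>z k l. norm z = \<rho> \<Longrightarrow> k \<le> n \<Longrightarrow> l \<le> n \<Longrightarrow> f ((z + \<i> * of_nat k / 2)\<^sup>2) \<noteq> 0 \<and>
       ln (norm (f ((z + \<i> * of_nat k / 2)\<^sup>2))) - ln (norm (f ((z + \<i> * of_nat l / 2)\<^sup>2))) \<le> D"
    and A: "\<And>k. k \<le> n \<Longrightarrow> k \<noteq> l \<Longrightarrow> norm (A k x) \<le> exp E" and x: "norm x = \<rho>\<^sup>2" "\<rho> \<ge> 0"
  shows "norm (A l x) \<le> exp (real n + E + D)"
proof -
  define F where "F k = f (wilson_iter s k x)" for k
  have "(s x)\<^sup>2 = x" using s by (simp add: imag_cut_sqrt_def)
  hence "(norm (s x))\<^sup>2 = \<rho>\<^sup>2" using x by (metis norm_power)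
  hence z: "norm (s x) = \<rho>" using x by simp
  have F: "F k \<noteq> 0" "ln (norm (F k)) - ln (norm (F l)) \<le> D" if "k \<le> n" for k
    using ratio[OF z that l] by (auto simp: F_def wilson_iter_eq[OF s])
  \<comment> \<open>Nicely meromorphic functions are 0 at poles, so nonzero values make the equation
    applicable at x.\<close>
  have "\<forall>k\<le>n. \<not> is_pole f (wilson_iter s k x)"
    using F is_pole_zero_at_nicely_mero[OF f] unfolding F_def by blast
  hence "(\<Sum>k\<le>n. A k x * F k) = 0" using eq unfolding solves_wilson_eq_def F_def by blast
  moreover have "(\<Sum>k\<le>n. A k x * F k) = A l x * F l + (\<Sum>k\<in>{..n} - {l}. A k x * F k)"
    using l by (subst sum.remove[of _ l]) auto
  ultimately have "A l x * F l = - (\<Sum>k\<in>{..n} - {l}. A k x * F k)" by (simp add: eq_neg_iff_add_eq_0)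
  hence "norm (A l x) * norm (F l) = norm (\<Sum>k\<in>{..n} - {l}. A k x * F k)"
    by (metis norm_minus_cancel norm_mult)
  also have "\<dots> \<le> (\<Sum>k\<in>{..n} - {l}. norm (A k x) * norm (F k))"
    by (rule order.trans[OF norm_sum]) (simp add: norm_mult)
  also have "\<dots> \<le> (\<Sum>k\<in>{..n} - {l}. exp E * (exp D * norm (F l)))"
  proof (intro sum_mono mult_mono)
    fix k assume k: "k \<in> {..n} - {l}"
    show "norm (A k x) \<le> exp E" using A k by auto
    have "ln (norm (F k)) \<le> D + ln (norm (F l))" using F(2)[of k] k by simp
    hence "exp (ln (norm (F k))) \<le> exp (D + ln (norm (F l)))" by simp
    thus "norm (F k) \<le> exp D * norm (F l)" using F(1)[of k] F(1)[OF l] k by (simp add: exp_add)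
  qed auto
  also have "\<dots> = real n * (exp E * exp D) * norm (F l)" using l by simp
  finally have "norm (A l x) \<le> real n * (exp E * exp D)" using F(1)[OF l] by simp
  also have "real n \<le> exp (real n)" using exp_ge_add_one_self[of "real n"] by linarith
  finally show ?thesis by (simp add: exp_add mult_right_mono mult.assoc)
qed

theorem theorem6p5:
  fixes s :: "complex \<Rightarrow> complex"
    and n l :: nat
    and A :: "nat \<Rightarrow> complex \<Rightarrow> complex"
    and f :: "complex \<Rightarrow> complex"
  assumes "imag_cut_sqrt s"
    and "n \<ge> 1"
    and "\<And>k. k \<le> n \<Longrightarrow> A k holomorphic_on UNIV"
    and "l \<le> n"
    and "growth_order (A l) > Max ((\<lambda>k. growth_order (A k)) ` ({0..n} - {l}))"
    and "f nicely_meromorphic_on UNIV"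
    and "\<exists>x. f x \<noteq> 0"
    and "solves_wilson_eq s n A f"
  shows "growth_order f \<ge> growth_order (A l) + ereal (1 / 2)"
proof (rule ccontr)
  assume "\<not> ?thesis"
  hence less: "growth_order f < growth_order (A l) + ereal (1 / 2)" by simp
  obtain x0 where x0: "f x0 \<noteq> 0" using assms(7) by blast
  define K where "K = {0..n} - {l}"
  define m where "m = Max ((\<lambda>k. growth_order (A k)) ` K)"
  have finK: "finite K" by (simp add: K_def)
  have le_m: "growth_order (A k) \<le> m" if "k \<in> K" for k
    unfolding m_def using that finK by (intro Max_ge) auto
  \<comment> \<open>As n \<ge> 1, the maximum m is over a nonempty set and hence nonnegative; this
    makes the exponent \<beta> positive.\<close>
  have "K \<noteq> {}"
  proof
    assume "K = {}"
    hence "card {0..n} \<le> card {l}" by (intro card_mono) (auto simp: K_def)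
    thus False using assms(2) by simp
  qed
  then obtain k0 where "k0 \<in> K" by blast
  hence m0: "0 \<le> m" using le_m growth_order_nonneg order.trans by blast
  have "growth_order f - ereal (1/2) < growth_order (A l)"
    using less growth_order_nonneg[of f] by (cases "growth_order f"; cases "growth_order (A l)") auto
  moreover have "m < growth_order (A l)" using assms(5) by (simp add: m_def K_def)
  ultimately have "max m (growth_order f - ereal (1/2)) < growth_order (A l)" by simp
  \<comment> \<open>Three real exponents \<beta> < \<gamma> < \<tau>: \<beta> bounds the
    characteristics, \<gamma> the moduli and ratios, \<tau> the coefficient with index l. A finite
    \<tau> also serves when that coefficient has infinite order.\<close>
  then obtain \<tau> where \<tau>: "max m (growth_order f - ereal (1/2)) < ereal \<tau>" "ereal \<tau> < growth_order (A l)"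
    using ereal_dense2 by blast
  then obtain \<beta> where \<beta>: "max m (growth_order f - ereal (1/2)) < ereal \<beta>" "ereal \<beta> < ereal \<tau>"
    using ereal_dense2 by blast
  have "0 < ereal \<beta>" using m0 \<beta>(1) by (meson max_less_iff_conj order_le_less_trans)
  hence \<beta>0: "0 < \<beta>" by simp
  define \<gamma> where "\<gamma> = (\<beta> + \<tau>) / 2"
  have \<gamma>: "\<beta> < \<gamma>" "\<gamma> < \<tau>" "0 < \<gamma>" using \<beta> \<beta>0 by (auto simp: \<gamma>_def)
  have "growth_order f < ereal (\<beta> + 1/2)"
    using \<beta>(1) growth_order_nonneg[of f] by (cases "growth_order f") auto
  hence "eventually (\<lambda>r. nevanlinna_char f r \<le> r powr (\<beta> + 1/2)) at_top"
    using \<beta>0 by (intro growth_order_less_imp_char_le) auto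
  note shifted_value_ratio_growth[OF assms(6) x0 \<beta>0 \<gamma>(1) assms(2) this]
  \<comment> \<open>With P = sqrt r the good circle |x| = \<rho>^2 lies between radii r and 4r;
    hence the other coefficients are bounded up to 4r below.\<close>
  hence ratio: "eventually (\<lambda>r. \<exists>\<rho>\<ge>sqrt r. \<rho> \<le> 2 * sqrt r \<and> (\<forall>z. norm z = \<rho> \<longrightarrow> (\<forall>k\<le>n. \<forall>l\<le>n.
     f ((z + \<i> * of_nat k / 2)\<^sup>2) \<noteq> 0 \<and>
     ln (norm (f ((z + \<i> * of_nat k / 2)\<^sup>2))) - ln (norm (f ((z + \<i> * of_nat l / 2)\<^sup>2))) \<le> ((sqrt r)\<^sup>2) powr \<gamma>))) at_top"
    by (rule eventually_compose_filterlim) (rule sqrt_at_top)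
  have "eventually (\<lambda>r. \<forall>x. norm x \<le> r \<longrightarrow> norm (A k x) \<le> exp (r powr \<gamma>)) at_top" if "k \<in> K" for k
  proof (rule entire_modulus_bound[OF _ \<beta>0 \<gamma>(1)])
    show "A k holomorphic_on UNIV" using that assms(3) by (auto simp: K_def)
    have "growth_order (A k) < ereal \<beta>" using le_m[OF that] \<beta>(1) by auto
    thus "eventually (\<lambda>r. nevanlinna_char (A k) r \<le> r powr \<beta>) at_top"
      using \<beta>0 by (rule growth_order_less_imp_char_le)
  qed
  hence "eventually (\<lambda>r. \<forall>k\<in>K. \<forall>x. norm x \<le> r \<longrightarrow> norm (A k x) \<le> exp (r powr \<gamma>)) at_top"
    using finK by (simp add: eventually_ball_finite)
  moreover have "filterlim (\<lambda>r::real. 4 * r) at_top at_top" by real_asymp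
  ultimately have coeff: "eventually (\<lambda>r. \<forall>k\<in>K. \<forall>x. norm x \<le> 4 * r \<longrightarrow> norm (A k x) \<le> exp ((4 * r) powr \<gamma>)) at_top"
    by (rule eventually_compose_filterlim)
  have "eventually (\<lambda>r. real n + (4 * r) powr \<gamma> + r powr \<gamma> \<le> r powr \<tau>) at_top"
    using \<gamma> by real_asymp
  with ratio coeff eventually_ge_at_top[of 1]
  have "eventually (\<lambda>r. \<forall>x. norm x = r \<longrightarrow> norm (A l x) \<le> exp (r powr \<tau>)) at_top"
  proof eventually_elim
    case (elim r)
    obtain \<rho> where \<rho>: "sqrt r \<le> \<rho>" "\<rho> \<le> 2 * sqrt r" and rat: "\<And>z k l. norm z = \<rho> \<Longrightarrow> k \<le> n \<Longrightarrow> l \<le> n \<Longrightarrow>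
      f ((z + \<i> * of_nat k / 2)\<^sup>2) \<noteq> 0 \<and>
      ln (norm (f ((z + \<i> * of_nat k / 2)\<^sup>2))) - ln (norm (f ((z + \<i> * of_nat l / 2)\<^sup>2))) \<le> r powr \<gamma>"
      using elim by auto
    have sr: "0 < sqrt r" using elim by simp
    have \<rho>r: "r \<le> \<rho>\<^sup>2" "\<rho>\<^sup>2 \<le> 4 * r"
      using power_mono[OF \<rho>(1), of 2] power_mono[OF \<rho>(2), of 2] sr \<rho> elim
      by (auto simp: power_mult_distrib)
    show ?case
    proof (intro allI impI)
      fix x :: complex assume x: "norm x = r"
      have hol: "A l holomorphic_on UNIV" using assms(3,4) by blast
      have "norm (A l x) \<le> exp (real n + (4 * r) powr \<gamma> + r powr \<gamma>)"
      \<comment> \<open>The estimate is available only on |y| = \<rho>^2, and r \<le> \<rho>^2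
        carries it inward to |x| = r.\<close>
      proof (rule maximum_modulus_frontier[where f = "A l" and S = "cball 0 (\<rho>\<^sup>2)"])
        show "A l holomorphic_on interior (cball 0 (\<rho>\<^sup>2))" using hol by (rule holomorphic_on_subset) simp
        show "continuous_on (closure (cball 0 (\<rho>\<^sup>2))) (A l)"
          using hol by (meson holomorphic_on_imp_continuous_on holomorphic_on_subset subset_UNIV)
        show "x \<in> cball 0 (\<rho>\<^sup>2)" using x \<rho>r by simp
        fix y :: complex assume "y \<in> frontier (cball 0 (\<rho>\<^sup>2))"
        hence y: "norm y = \<rho>\<^sup>2" using frontier_cball[of "\<rho>\<^sup>2" 0] by simp
        show "norm (A l y) \<le> exp (real n + (4 * r) powr \<gamma> + r powr \<gamma>)"
        proof (rule wilson_coefficient_bound[OF assms(1,2,4,6,8)])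
          show "f ((z + \<i> * of_nat k / 2)\<^sup>2) \<noteq> 0 \<and>
            ln (norm (f ((z + \<i> * of_nat k / 2)\<^sup>2))) - ln (norm (f ((z + \<i> * of_nat l / 2)\<^sup>2))) \<le> r powr \<gamma>"
            if "norm z = \<rho>" "k \<le> n" "l \<le> n" for z k l using rat that by blast
          show "norm (A k y) \<le> exp ((4 * r) powr \<gamma>)" if "k \<le> n" "k \<noteq> l" for k
            using elim that y \<rho>r by (auto simp: K_def)
        qed (use sr \<rho> y in auto)
      qed auto
      also have "\<dots> \<le> exp (r powr \<tau>)" using elim by simp
      finally show "norm (A l x) \<le> exp (r powr \<tau>)" .
    qed
  qed
  hence "growth_order (A l) \<le> ereal \<tau>"
    using assms(3,4) \<gamma> by (intro growth_order_entire_le) auto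
  thus False using \<tau>(2) by simp
qed

end
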